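(* Let $X_1:\Omega_1\to\mathbb{E}^3_1$ and $X_2:\Omega_2\to\mathbb{E}^3_1$ ($\Omega_1,\Omega_2\subset\mathbb{C}$ open) be maximal surfaces with Weierstrass data $(g_1,f_1)$ and $(g_2,f_2)$ respectively. Let $\tilde\Omega=\Omega_1\mathbf{e}+\Omega_2\mathbf{e}^\dagger\subset\mathbb{BC}$, and suppose that the bicomplex functions $\tilde g:=g_1\mathbf{e}+g_2\mathbf{e}^\dagger$ and $\tilde f:=f_1\mathbf{e}+f_2\mathbf{e}^\dagger$ on $\tilde\Omega$ (i.e. $\tilde g(\beta_1\mathbf{e}+\beta_2\mathbf{e}^\dagger)=g_1(\beta_1)\mathbf{e}+g_2(\beta_2)\mathbf{e}^\dagger$, and similarly for $\tilde f$) both satisfy $\tilde F(\tilde z^* )=(\tilde F(\tilde z))^*$ for all $\tilde z\in\tilde\Omega\cap\tilde\Omega^*$. Then $$\hat X=\tfrac12(X_1+X_2)\big|_{\mathbb{D}}$$ is a timelike minimal surface on $\tilde\Omega\cap\mathbb{D}$ with Weierstrass data $(\tilde g|_{\mathbb{D}},\tilde f|_{\mathbb{D}})$.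
   Context: $\mathbb{E}^3_1$ is $\mathbb{R}^3$ with metric $dx^2+dy^2-dz^2$. Bicomplex numbers: $\mathbb{BC}=\{z_1+\mathbf{j}z_2: z_1,z_2\in\mathbb{C}(\mathbf{i})\}$, a commutative ring with $\mathbf{i}^2=\mathbf{j}^2=-1$, $\mathbf{k}=\mathbf{i}\mathbf{j}=\mathbf{j}\mathbf{i}$, so $\mathbf{k}^2=1$. Split-complex numbers: $\mathbb{D}=\{x+\mathbf{k}y:x,y\in\mathbb{R}\}\subset\mathbb{BC}$, with $\operatorname{Re}(x+\mathbf{k}y)=x$, $\operatorname{Im}(x+\mathbf{k}y)=y$. Put $\mathbf{e}=\frac{1+\mathbf{k}}2$, $\mathbf{e}^\dagger=\frac{1-\mathbf{k}}2$; these are idempotents with $\mathbf{e}\mathbf{e}^\dagger=0$, $\mathbf{e}+\mathbf{e}^\dagger=1$. Every $\tilde z\in\mathbb{BC}$ is uniquely $\beta_1\mathbf{e}+\beta_2\mathbf{e}^\dagger$ with $\beta_1,\beta_2\in\mathbb{C}(\mathbf{i})$, and $\tilde z\in\mathbb{D}$ iff $\beta_1,\beta_2\in\mathbb{R}$. The conjugate is $\tilde z^*=\bar\beta_1\mathbf{e}+\bar\beta_2\mathbf{e}^\dagger$, and $\tilde\Omega^*=\{\tilde z^*:\tilde z\in\tilde\Omega\}$. For a function on $\tilde\Omega$, $|_{\mathbb{D}}$ is restriction to $\tilde\Omega\cap\mathbb{D}$; $X_1+X_2$ is regarded as the function $\beta_1\mathbf{e}+\beta_2\mathbf{e}^\dagger\mapsto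 X_1(\beta_1)+X_2(\beta_2)$ on $\tilde\Omega$, so $\hat X(a\mathbf{e}+b\mathbf{e}^\dagger)=\frac12(X_1(a)+X_2(b))$ for $a\in\Omega_1\cap\mathbb{R}$, $b\in\Omega_2\cap\mathbb{R}$. Maximal surface with Weierstrass data $(g,f)$ on open $\Omega\subset\mathbb{C}$: $g$ is meromorphic and $f$ holomorphic on $\Omega$, with $fg^2$ holomorphic on $\Omega$, $\operatorname{Im}(g)\not\equiv0$, $\operatorname{Re}\int_\gamma(1-g^2,2g,1+g^2)f\,dz=0$ for all closed loops $\gamma$ in $\Omega$, and $X(z)=\operatorname{Re}\int_{z_0}^z(1-g^2,2g,1+g^2)f\,dz$. Timelike minimal surface: a $C^2$ map $X(u,v)$ from an open subset of $\mathbb{R}^2\cong\mathbb{D}$ ($u+\mathbf{k}v$) to $\mathbb{E}^3_1$ with $\langle X_u,X_u\rangle=-\langle X_v,X_v\rangle$, $\langle X_u,X_v\rangle=0$ and $X_{uu}-X_{vv}=0$ (the induced metric may degenerate at some points). It has Weierstrass data $(\hat g,\hat f)$, where $\hat g$ is split-meromorphic, $\hat f$ and $\hat f\hat g^2$ are split-holomorphic and $\operatorname{Im}(\hat g)\not\equiv0$, if $\hat X(\hat z)=\operatorname{Re}\int^{\hat z}(1-\hat g^2,2\hat g,1+\hat g^2)\hat f\,d\hat z$ (up to additive constants on components), the real periods over closed loops being zero. Here split-holomorphic means locally given by power series in $\hat z$. Split-meromorphic functions are reciprocals of such functions and, more generally, restrictions to $\mathbb{D}$ of bicomplex meromorphic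 functions $\tilde F(\beta_1\mathbf{e}+\beta_2\mathbf{e}^\dagger)=G_1(\beta_1)\mathbf{e}+G_2(\beta_2)\mathbf{e}^\dagger$ ($G_1,G_2$ meromorphic) satisfying the conjugation symmetry $\tilde F(\tilde z^* )=(\tilde F(\tilde z))^*$ for all $\tilde z\in\tilde\Omega\cap\tilde\Omega^*$ are regarded as split-meromorphic.
   Formalization: "Im(g) not identically 0" is required on each connected component of the domain, in hypotheses and conclusion (vacuous if the intersection with D is empty); read on the whole of a disconnected domain, or for an empty intersection, the claim would be false. *)

theory Defs
  imports "HOL-Complex_Analysis.Complex_Analysis"
begin

section \<open>Bicomplex numbers\<close>

text \<open>\<^term>\<open>Bicomplex z1 z2\<close> is the number $z_1 + \mathbf{j} z_2$.\<close>

datatype bicomplex = Bicomplex (bc1: complex) (bc2: complex)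

lemma bicomplex_eq_iff: "p = q \<longleftrightarrow> bc1 p = bc1 q \<and> bc2 p = bc2 q"
  by (cases p; cases q) simp

instantiation bicomplex :: comm_ring_1
begin

definition "0 = Bicomplex 0 0"
definition "1 = Bicomplex 1 0"
definition "p + q = Bicomplex (bc1 p + bc1 q) (bc2 p + bc2 q)"
definition "p - q = Bicomplex (bc1 p - bc1 q) (bc2 p - bc2 q)"
definition "- p = Bicomplex (- bc1 p) (- bc2 p)"
definition "p * q = Bicomplex (bc1 p * bc1 q - bc2 p * bc2 q) (bc1 p * bc2 q + bc2 p * bc1 q)"

instance
  by standard
    (auto simp: zero_bicomplex_def one_bicomplex_def plus_bicomplex_def minus_bicomplex_def
      uminus_bicomplex_def times_bicomplex_def algebra_simps)

end

instantiation bicomplex :: real_inner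
begin

definition "scaleR r p = Bicomplex (r *\<^sub>R bc1 p) (r *\<^sub>R bc2 p)"
definition "inner p q = inner (bc1 p) (bc1 q) + inner (bc2 p) (bc2 q)"
definition "norm (p :: bicomplex) = sqrt (inner p p)"
definition "sgn (p :: bicomplex) = inverse (norm p) *\<^sub>R p"
definition "dist (p :: bicomplex) q = norm (p - q)"
definition
  "(uniformity :: (bicomplex \<times> bicomplex) filter) = (INF e\<in>{0 <..}. principal {(x, y). dist x y < e})"
definition
  "open (U :: bicomplex set) \<longleftrightarrow> (\<forall>x\<in>U. eventually (\<lambda>(x', y). x' = x \<longrightarrow> y \<in> U) uniformity)"

instance
proof
  fix p q r :: bicomplex and a b :: real
  show "dist p q = norm (p - q)" by (rule dist_bicomplex_def)
  show "sgn p = inverse (norm p) *\<^sub>R p" by (rule sgn_bicomplex_def)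
  show "norm p = sqrt (inner p p)" by (rule norm_bicomplex_def)
  show "inner p q = inner q p" by (simp add: inner_bicomplex_def inner_commute)
  show "0 \<le> inner p p" by (simp add: inner_bicomplex_def)
  show "(inner p p = 0) = (p = 0)"
    by (simp add: inner_bicomplex_def add_nonneg_eq_0_iff zero_bicomplex_def bicomplex_eq_iff)
qed (auto simp: scaleR_bicomplex_def inner_bicomplex_def plus_bicomplex_def algebra_simps
      scaleR_add_left scaleR_add_right inner_add_left
      uniformity_bicomplex_def open_bicomplex_def)

end

instantiation bicomplex :: euclidean_space
begin

definition "Basis = (\<lambda>b. Bicomplex b 0) ` Basis \<union> (\<lambda>b. Bicomplex 0 b) ` (Basis :: complex set)"

instance
proof
  show "finite (Basis :: bicomplex set)" "(Basis :: bicomplex set) \<noteq> {}"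
    by (simp_all add: Basis_bicomplex_def)
next
  fix u v :: bicomplex
  assume "u \<in> Basis" "v \<in> Basis"
  then show "inner u v = (if u = v then 1 else 0)"
    by (auto simp: Basis_bicomplex_def inner_bicomplex_def inner_Basis split: if_splits)
next
  fix x :: bicomplex
  show "(\<forall>u\<in>Basis. inner x u = 0) \<longleftrightarrow> x = 0"
    by (auto simp: Basis_bicomplex_def inner_bicomplex_def ball_Un euclidean_all_zero_iff
        zero_bicomplex_def bicomplex_eq_iff)
qed

end

definition bc_of_complex :: "complex \<Rightarrow> bicomplex"
  where "bc_of_complex z = Bicomplex z 0"

definition bc_j :: bicomplex
  where "bc_j = Bicomplex 0 1"

definition bc_k :: bicomplex
  where "bc_k = bc_of_complex \<i> * bc_j"

definition bc_e :: bicomplex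
  where "bc_e = (1/2) *\<^sub>R (1 + bc_k)"

definition bc_e' :: bicomplex
  where "bc_e' = (1/2) *\<^sub>R (1 - bc_k)"

definition bc_idem :: "complex \<Rightarrow> complex \<Rightarrow> bicomplex"
  where "bc_idem \<beta>1 \<beta>2 = bc_of_complex \<beta>1 * bc_e + bc_of_complex \<beta>2 * bc_e'"

text \<open>The coefficients of a bicomplex number with respect to the two idempotents.\<close>

definition idem1 :: "bicomplex \<Rightarrow> complex"
  where "idem1 q = bc1 q - \<i> * bc2 q"

definition idem2 :: "bicomplex \<Rightarrow> complex"
  where "idem2 q = bc1 q + \<i> * bc2 q"

lemma bc_idem_eq: "bc_idem \<beta>1 \<beta>2 = Bicomplex ((\<beta>1 + \<beta>2) / 2) (\<i> * (\<beta>1 - \<beta>2) / 2)"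
  by (simp add: bc_idem_def bc_of_complex_def bc_e_def bc_e'_def bc_k_def bc_j_def
      times_bicomplex_def plus_bicomplex_def minus_bicomplex_def one_bicomplex_def
      scaleR_bicomplex_def scaleR_conv_of_real field_simps)

lemma idem_bc_idem [simp]: "idem1 (bc_idem \<beta>1 \<beta>2) = \<beta>1" "idem2 (bc_idem \<beta>1 \<beta>2) = \<beta>2"
  by (simp_all add: bc_idem_eq idem1_def idem2_def field_simps)

lemma bc_idem_idem [simp]: "bc_idem (idem1 q) (idem2 q) = q"
  by (simp add: bc_idem_eq bicomplex_eq_iff idem1_def idem2_def field_simps)

lemma bc_idem_eq_iff: "q = bc_idem \<beta>1 \<beta>2 \<longleftrightarrow> \<beta>1 = idem1 q \<and> \<beta>2 = idem2 q"
  by (metis bc_idem_idem idem_bc_idem)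

lemma bc_k_squared: "bc_k * bc_k = 1"
  by (simp add: bc_k_def bc_of_complex_def bc_j_def times_bicomplex_def one_bicomplex_def)

definition bc_cnj :: "bicomplex \<Rightarrow> bicomplex"
  where "bc_cnj q = bc_idem (cnj (idem1 q)) (cnj (idem2 q))"

definition bc_domain :: "complex set \<Rightarrow> complex set \<Rightarrow> bicomplex set"
  where "bc_domain \<Omega>1 \<Omega>2 = {bc_idem \<beta>1 \<beta>2 | \<beta>1 \<beta>2. \<beta>1 \<in> \<Omega>1 \<and> \<beta>2 \<in> \<Omega>2}"

definition bc_fun :: "(complex \<Rightarrow> complex) \<Rightarrow> (complex \<Rightarrow> complex) \<Rightarrow> bicomplex \<Rightarrow> bicomplex"
  where "bc_fun G1 G2 q = bc_idem (G1 (idem1 q)) (G2 (idem2 q))"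

definition bc_symmetric_on :: "(bicomplex \<Rightarrow> bicomplex) \<Rightarrow> bicomplex set \<Rightarrow> bool"
  where "bc_symmetric_on F \<Omega> \<longleftrightarrow> (\<forall>q \<in> \<Omega> \<inter> bc_cnj ` \<Omega>. F (bc_cnj q) = bc_cnj (F q))"


section \<open>Split-complex numbers and split-holomorphic functions\<close>

definition split_of :: "real \<Rightarrow> real \<Rightarrow> bicomplex"
  where "split_of x y = bc_of_complex (of_real x) + bc_k * bc_of_complex (of_real y)"

definition split_complex :: "bicomplex set"
  where "split_complex = {split_of x y | x y. True}"

text \<open>
  Real and imaginary part of $x + \mathbf{k} y = x + \mathbf{j} (\mathbf{i} y)$; meaningful on
  \<^const>\<open>split_complex\<close> only.
\<close>

definition split_Re :: "bicomplex \<Rightarrow> real"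
  where "split_Re q = Re (bc1 q)"

definition split_Im :: "bicomplex \<Rightarrow> real"
  where "split_Im q = Im (bc2 q)"

lemma split_Re_Im [simp]: "split_Re (split_of x y) = x" "split_Im (split_of x y) = y"
  by (simp_all add: split_Re_def split_Im_def split_of_def bc_k_def bc_of_complex_def bc_j_def
      times_bicomplex_def plus_bicomplex_def)

lemma idem_split_of: "idem1 (split_of x y) = of_real (x + y)" "idem2 (split_of x y) = of_real (x - y)"
  by (simp_all add: idem1_def idem2_def split_of_def bc_k_def bc_of_complex_def bc_j_def
      times_bicomplex_def plus_bicomplex_def algebra_simps)

lemma bc_idem_in_split_complex_iff:
  "bc_idem \<beta>1 \<beta>2 \<in> split_complex \<longleftrightarrow> \<beta>1 \<in> \<real> \<and> \<beta>2 \<in> \<real>"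
proof
  assume "bc_idem \<beta>1 \<beta>2 \<in> split_complex"
  then obtain x y where "split_of x y = bc_idem \<beta>1 \<beta>2"
    by (auto simp: split_complex_def)
  then show "\<beta>1 \<in> \<real> \<and> \<beta>2 \<in> \<real>"
    by (simp only: bc_idem_eq_iff idem_split_of Reals_of_real)
next
  assume "\<beta>1 \<in> \<real> \<and> \<beta>2 \<in> \<real>"
  then obtain a b where "\<beta>1 = of_real a" "\<beta>2 = of_real b"
    by (auto elim!: Reals_cases)
  then have "split_of ((a + b) / 2) ((a - b) / 2) = bc_idem \<beta>1 \<beta>2"
    by (simp add: bc_idem_eq_iff idem_split_of field_simps)
  then show "bc_idem \<beta>1 \<beta>2 \<in> split_complex"
    by (auto simp: split_complex_def intro: exI sym)
qed

text \<open>The point $(u,v)$ of the plane stands for $u + \mathbf{k} v$.\<close>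

definition split_coords :: "bicomplex set \<Rightarrow> (real \<times> real) set"
  where "split_coords S = {(u, v). split_of u v \<in> S}"

definition split_open :: "bicomplex set \<Rightarrow> bool"
  where "split_open S \<longleftrightarrow> S \<subseteq> split_complex \<and> open (split_coords S)"

definition split_analytic_at :: "(bicomplex \<Rightarrow> bicomplex) \<Rightarrow> bicomplex \<Rightarrow> bool"
  where "split_analytic_at F p \<longleftrightarrow>
    (\<exists>a r. r > 0 \<and> (\<forall>n. a n \<in> split_complex) \<and>
       (\<forall>q \<in> split_complex. dist q p < r \<longrightarrow> (\<lambda>n. a n * (q - p) ^ n) sums F q))"

definition split_holomorphic_on :: "(bicomplex \<Rightarrow> bicomplex) \<Rightarrow> bicomplex set \<Rightarrow> bool"
  where "split_holomorphic_on F S \<longleftrightarrow> (\<forall>p \<in> S. split_analytic_at F p)"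

text \<open>
  Values at poles follow the convention of \<^const>\<open>nicely_meromorphic_on\<close>: a complex
  meromorphic function takes the value 0 at its poles. Accordingly, each idempotent component of a
  split-meromorphic function is 0 where that component has a pole, both for reciprocals and for
  restrictions of bicomplex meromorphic functions. Since \<^term>\<open>inverse 0 = 0\<close>, the function
  \<^term>\<open>bc_fun inverse inverse\<close> is the reciprocal with this convention; the density
  condition excludes denominators that are zero divisors on an open set.
\<close>

definition split_meromorphic_on :: "(bicomplex \<Rightarrow> bicomplex) \<Rightarrow> bicomplex set \<Rightarrow> bool"
  where "split_meromorphic_on F S \<longleftrightarrow>
    (\<exists>h. split_holomorphic_on h S \<and> S \<subseteq> closure {q \<in> S. h q dvd 1} \<and>
       (\<forall>q \<in> S. F q = bc_fun inverse inverse (h q))) \<or>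
    (\<exists>\<Omega>1 \<Omega>2 G1 G2. open \<Omega>1 \<and> open \<Omega>2 \<and>
       G1 nicely_meromorphic_on \<Omega>1 \<and> G2 nicely_meromorphic_on \<Omega>2 \<and>
       bc_symmetric_on (bc_fun G1 G2) (bc_domain \<Omega>1 \<Omega>2) \<and>
       S = bc_domain \<Omega>1 \<Omega>2 \<inter> split_complex \<and>
       (\<forall>q \<in> S. F q = bc_fun G1 G2 q))"

text \<open>
  \<^term>\<open>H\<close> is the split-holomorphic function on \<^term>\<open>S\<close> that an expression
  \<^term>\<open>F\<close> in split-meromorphic functions defines after its removable singularities have
  been filled in. By the density condition \<^term>\<open>H\<close> is unique on \<^term>\<open>S\<close>.
\<close>

definition split_extends :: "(bicomplex \<Rightarrow> bicomplex) \<Rightarrow> (bicomplex \<Rightarrow> bicomplex) \<Rightarrow> bicomplex set \<Rightarrow> bool"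
  where "split_extends H F S \<longleftrightarrow>
    split_holomorphic_on H S \<and>
    S \<subseteq> closure {q \<in> S. split_analytic_at F q} \<and>
    (\<forall>q \<in> S. split_analytic_at F q \<longrightarrow> H q = F q)"

definition split_contour_integral :: "(real \<Rightarrow> bicomplex) \<Rightarrow> (bicomplex \<Rightarrow> bicomplex) \<Rightarrow> bicomplex"
  where "split_contour_integral \<gamma> F =
    integral {0..1} (\<lambda>t. F (\<gamma> t) * vector_derivative \<gamma> (at t within {0..1}))"


section \<open>Maximal surfaces and timelike minimal surfaces\<close>

definition lorentz :: "real^3 \<Rightarrow> real^3 \<Rightarrow> real"
  where "lorentz x y = x$1 * y$1 + x$2 * y$2 - x$3 * y$3"

definition weierstrass_vec :: "'a::comm_ring_1 \<Rightarrow> 'a \<Rightarrow> 'a^3"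
  where "weierstrass_vec g f = vector [(1 - g\<^sup>2) * f, 2 * g * f, (1 + g\<^sup>2) * f]"

text \<open>
  At the poles of \<^term>\<open>g\<close> the products with \<^term>\<open>f\<close> have to be read as their
  continuous extensions, whence \<^const>\<open>remove_sings\<close>.
\<close>

definition weierstrass_form ::
  "(complex \<Rightarrow> complex) \<Rightarrow> (complex \<Rightarrow> complex) \<Rightarrow> 3 \<Rightarrow> complex \<Rightarrow> complex"
  where "weierstrass_form g f i = remove_sings (\<lambda>z. weierstrass_vec (g z) (f z) $ i)"

text \<open>
  The open set \<^term>\<open>\<Omega>\<close> need not be connected: there is a base point $z_0$ in every
  component, and \<^term>\<open>Im (g z)\<close> vanishes identically on no component.
\<close>

definition maximal_surface_data ::
  "complex set \<Rightarrow> (complex \<Rightarrow> real^3) \<Rightarrow> (complex \<Rightarrow> complex) \<Rightarrow> (complex \<Rightarrow> complex) \<Rightarrow> bool"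
  where "maximal_surface_data \<Omega> X g f \<longleftrightarrow>
    open \<Omega> \<and>
    g nicely_meromorphic_on \<Omega> \<and>
    f holomorphic_on \<Omega> \<and>
    remove_sings (\<lambda>z. f z * (g z)\<^sup>2) holomorphic_on \<Omega> \<and>
    (\<forall>C \<in> components \<Omega>. \<exists>z \<in> C. \<not> is_pole g z \<and> Im (g z) \<noteq> 0) \<and>
    (\<forall>\<gamma>. valid_path \<gamma> \<and> path_image \<gamma> \<subseteq> \<Omega> \<and> pathfinish \<gamma> = pathstart \<gamma> \<longrightarrow>
       (\<forall>i. Re (contour_integral \<gamma> (weierstrass_form g f i)) = 0)) \<and>
    (\<forall>C \<in> components \<Omega>. \<exists>z0 \<in> C. \<forall>z \<in> C. \<forall>\<gamma>.
       valid_path \<gamma> \<and> path_image \<gamma> \<subseteq> \<Omega> \<and> pathstart \<gamma> = z0 \<and> pathfinish \<gamma> = z \<longrightarrow>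
       (\<forall>i. X z $ i = Re (contour_integral \<gamma> (weierstrass_form g f i))))"

definition partial_u :: "(real \<times> real \<Rightarrow> real^3) \<Rightarrow> real \<times> real \<Rightarrow> real^3"
  where "partial_u Y p = vector_derivative (\<lambda>t. Y (t, snd p)) (at (fst p))"

definition partial_v :: "(real \<times> real \<Rightarrow> real^3) \<Rightarrow> real \<times> real \<Rightarrow> real^3"
  where "partial_v Y p = vector_derivative (\<lambda>t. Y (fst p, t)) (at (snd p))"

definition C1_on :: "(real \<times> real) set \<Rightarrow> (real \<times> real \<Rightarrow> real^3) \<Rightarrow> bool"
  where "C1_on U Y \<longleftrightarrow>
    (\<forall>p \<in> U. (\<lambda>t. Y (t, snd p)) differentiable (at (fst p)) \<and>
             (\<lambda>t. Y (fst p, t)) differentiable (at (snd p))) \<and>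
    continuous_on U (partial_u Y) \<and> continuous_on U (partial_v Y)"

definition C2_on :: "(real \<times> real) set \<Rightarrow> (real \<times> real \<Rightarrow> real^3) \<Rightarrow> bool"
  where "C2_on U Y \<longleftrightarrow> C1_on U Y \<and> C1_on U (partial_u Y) \<and> C1_on U (partial_v Y)"

definition timelike_minimal_surface :: "bicomplex set \<Rightarrow> (bicomplex \<Rightarrow> real^3) \<Rightarrow> bool"
  where "timelike_minimal_surface S X \<longleftrightarrow>
    split_open S \<and>
    (let U = split_coords S; Y = (\<lambda>(u, v). X (split_of u v)) in
      C2_on U Y \<and>
      (\<forall>p \<in> U.
         lorentz (partial_u Y p) (partial_u Y p) = - lorentz (partial_v Y p) (partial_v Y p) \<and>
         lorentz (partial_u Y p) (partial_v Y p) = 0 \<and>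
         partial_u (partial_u Y) p - partial_v (partial_v Y) p = 0))"

text \<open>
  As in the maximal case, the condition on the imaginary part of \<^term>\<open>g\<close> is imposed on
  every component of \<^term>\<open>S\<close>, at points where \<^term>\<open>g\<close> has no pole.
\<close>

definition split_weierstrass_data ::
  "bicomplex set \<Rightarrow> (bicomplex \<Rightarrow> real^3) \<Rightarrow> (bicomplex \<Rightarrow> bicomplex) \<Rightarrow> (bicomplex \<Rightarrow> bicomplex) \<Rightarrow> bool"
  where "split_weierstrass_data S X g f \<longleftrightarrow>
    split_meromorphic_on g S \<and>
    split_holomorphic_on f S \<and>
    (\<exists>H. split_extends H (\<lambda>q. f q * (g q)\<^sup>2) S) \<and>
    (\<forall>C \<in> components S. \<exists>q \<in> C. split_analytic_at g q \<and> split_Im (g q) \<noteq> 0) \<and>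
    (\<exists>\<Phi> :: 3 \<Rightarrow> bicomplex \<Rightarrow> bicomplex.
      (\<forall>i. split_extends (\<Phi> i) (\<lambda>q. weierstrass_vec (g q) (f q) $ i) S) \<and>
      (\<forall>\<gamma>. valid_path \<gamma> \<and> path_image \<gamma> \<subseteq> S \<and> pathfinish \<gamma> = pathstart \<gamma> \<longrightarrow>
         (\<forall>i. split_Re (split_contour_integral \<gamma> (\<Phi> i)) = 0)) \<and>
      (\<forall>C \<in> components S. \<exists>q0 \<in> C. \<exists>c :: real^3. \<forall>q \<in> C. \<forall>\<gamma>.
         valid_path \<gamma> \<and> path_image \<gamma> \<subseteq> S \<and> pathstart \<gamma> = q0 \<and> pathfinish \<gamma> = q \<longrightarrow>
         (\<forall>i. X q $ i = c $ i + split_Re (split_contour_integral \<gamma> (\<Phi> i)))))"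

definition half_sum :: "(complex \<Rightarrow> real^3) \<Rightarrow> (complex \<Rightarrow> real^3) \<Rightarrow> bicomplex \<Rightarrow> real^3"
  where "half_sum X1 X2 q = (1/2) *\<^sub>R (X1 (idem1 q) + X2 (idem2 q))"

end

theory Submission
  imports Defs
begin

text \<open>
  Bicomplex multiplication is componentwise in idempotent coordinates, so every object splits into
  its two components. The conjugation symmetry makes the data real on the real points of both
  domains; hence their Taylor coefficients there are real, which gives split-holomorphic functions,
  and split-complex contour integrals are pairs of complex contour integrals. In coordinates,
  \<open>X(u,v) = (X1(u + v) + X2(u - v)) / 2\<close> is a d'Alembert solution of the wave equation whose two
  generating curves have real null velocities, which yields the conformality relations.
\<close>

section \<open>Idempotent components and split-analyticity\<close>

text \<open>Poles shape the proof. Where \<open>g1\<close> or \<open>g2\<close> has a pole, the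
  integrands exist only after their singularities are filled in, and \<open>split_extends\<close>
  asks for more than a filled-in function: it has to equal the raw expression wherever that is
  split-analytic, and such points have to be dense. A pole of \<open>g1\<close> can spoil every
  point of the real plane with that first coordinate, so the exceptional set consists of null lines;
  a small real translation changes both coordinates and leaves them. Reality of the integrands at a
  pole is likewise a limit statement, taken along the real axis. The condition on the
  split-imaginary part of the Gauss map is not inherited directly. At real points it is half the
  difference of the real numbers \<open>g1\<close> and \<open>g2\<close>, while the hypothesis
  provides a nonreal value of \<open>g1\<close> somewhere in each component. The identity theorem
  links the two. The argument for reality tests pairs of real points, one in each domain, so an
  empty real domain is treated separately.\<close>

lemma idem_arith [simp]:
  "idem1 0 = 0" "idem2 0 = 0" "idem1 1 = 1" "idem2 1 = 1"
  "idem1 (p + q) = idem1 p + idem1 q" "idem2 (p + q) = idem2 p + idem2 q"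
  "idem1 (p - q) = idem1 p - idem1 q" "idem2 (p - q) = idem2 p - idem2 q"
  "idem1 (p * q) = idem1 p * idem1 q" "idem2 (p * q) = idem2 p * idem2 q"
  "idem1 (r *\<^sub>R p) = r *\<^sub>R idem1 p" "idem2 (r *\<^sub>R p) = r *\<^sub>R idem2 p"
  by (auto simp: idem1_def idem2_def zero_bicomplex_def one_bicomplex_def plus_bicomplex_def
      minus_bicomplex_def times_bicomplex_def scaleR_bicomplex_def algebra_simps)

lemma idem_power [simp]: "idem1 (p ^ n) = idem1 p ^ n" "idem2 (p ^ n) = idem2 p ^ n"
  by (induction n) auto

lemma idem_numeral [simp]: "idem1 (numeral n) = numeral n" "idem2 (numeral n) = numeral n"
  by (induction n) (simp_all only: numeral.simps idem_arith)

lemma idem_eqI: "idem1 p = idem1 q \<Longrightarrow> idem2 p = idem2 q \<Longrightarrow> p = q"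
  by (metis bc_idem_idem)

lemma linear_idem: "linear idem1" "linear idem2"
  by (auto intro!: linearI)

lemma bounded_linear_idem: "bounded_linear idem1" "bounded_linear idem2"
  by (simp_all add: linear_idem linear_conv_bounded_linear[symmetric])

lemma bounded_linear_bc_idem: "bounded_linear (\<lambda>z. bc_idem z 0)" "bounded_linear (bc_idem 0)"
  unfolding linear_conv_bounded_linear[symmetric] by (auto intro!: linearI idem_eqI)

text \<open>Sums, limits and integrals of bicomplex numbers are obtained from complex ones by
  embedding each coordinate with a bounded linear map and adding the two images.\<close>

lemma bc_idem_conv_add: "bc_idem z w = bc_idem z 0 + bc_idem 0 w"
  by (rule idem_eqI) auto

text \<open>The coefficients of \<open>bc1\<close> and \<open>bc2\<close> have modulus one, so the
  triangle inequality gives the factor 2. It is the reason why radii are halved wherever a bicomplex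
  distance has to control both coordinates.\<close>

lemma norm_idem_le: "norm (idem1 q) \<le> 2 * norm q" "norm (idem2 q) \<le> 2 * norm q"
proof -
  have q: "norm q = sqrt ((norm (bc1 q))\<^sup>2 + (norm (bc2 q))\<^sup>2)"
    by (simp add: norm_bicomplex_def inner_bicomplex_def power2_norm_eq_inner)
  have "norm (bc1 q) \<le> norm q" "norm (bc2 q) \<le> norm q"
    unfolding q by (rule real_le_rsqrt, simp)+
  moreover have "norm (idem1 q) \<le> norm (bc1 q) + norm (bc2 q)"
    unfolding idem1_def by (rule order_trans[OF norm_triangle_ineq4]) (simp add: norm_mult)
  moreover have "norm (idem2 q) \<le> norm (bc1 q) + norm (bc2 q)"
    unfolding idem2_def by (rule order_trans[OF norm_triangle_ineq]) (simp add: norm_mult)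
  ultimately show "norm (idem1 q) \<le> 2 * norm q" "norm (idem2 q) \<le> 2 * norm q"
    by linarith+
qed

lemma dist_idem_le: "dist (idem1 p) (idem1 q) \<le> 2 * dist p q" "dist (idem2 p) (idem2 q) \<le> 2 * dist p q"
  using norm_idem_le[of "p - q"] by (simp_all add: dist_norm)

lemma mem_bc_domain_iff: "q \<in> bc_domain A B \<longleftrightarrow> idem1 q \<in> A \<and> idem2 q \<in> B"
  unfolding bc_domain_def by (auto simp: bc_idem_eq_iff)

lemma mem_split_complex_iff: "q \<in> split_complex \<longleftrightarrow> idem1 q \<in> \<real> \<and> idem2 q \<in> \<real>"
  using bc_idem_in_split_complex_iff[of "idem1 q" "idem2 q"] by simp

lemma split_Re_idem: "split_Re q = Re (idem1 q + idem2 q) / 2"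
  by (simp add: split_Re_def idem1_def idem2_def)

lemma split_Im_idem: "split_Im q = Re (idem1 q - idem2 q) / 2"
  by (simp add: split_Im_def idem1_def idem2_def)

text \<open>A point with real coordinates is fixed by \<open>bc_cnj\<close>, hence lies in the
  domain and in its conjugate, and the symmetry makes its value fixed too. Since the symmetry speaks
  of pairs, each real point needs a real partner in the other domain here.\<close>

lemma bc_symmetric_on_bc_fun_real:
  assumes "bc_symmetric_on (bc_fun F1 F2) (bc_domain \<Omega>1 \<Omega>2)"
    and "z \<in> \<Omega>1 \<inter> \<real>" "w \<in> \<Omega>2 \<inter> \<real>"
  shows "F1 z \<in> \<real>" "F2 w \<in> \<real>"
proof -
  let ?q = "bc_idem z w"
  have "bc_cnj ?q = ?q" "?q \<in> bc_domain \<Omega>1 \<Omega>2"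
    using assms by (auto simp: bc_cnj_def mem_bc_domain_iff Reals_cnj_iff)
  then have "?q \<in> bc_domain \<Omega>1 \<Omega>2 \<inter> bc_cnj ` bc_domain \<Omega>1 \<Omega>2"
    by (metis IntI imageI)
  then have "bc_fun F1 F2 ?q = bc_cnj (bc_fun F1 F2 ?q)"
    using assms(1) \<open>bc_cnj ?q = ?q\<close> by (metis bc_symmetric_on_def)
  then show "F1 z \<in> \<real>" "F2 w \<in> \<real>"
    by (simp_all add: bc_fun_def bc_cnj_def bc_idem_eq_iff Reals_cnj_iff)
qed

text \<open>The derivative can be computed along the real axis, where the imaginary part of
  \<open>F\<close> vanishes near the point.\<close>

lemma deriv_in_Reals:
  assumes "F holomorphic_on \<Omega>" "open \<Omega>" "\<And>z. z \<in> \<Omega> \<inter> \<real> \<Longrightarrow> F z \<in> \<real>" "z \<in> \<Omega> \<inter> \<real>"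
  shows "deriv F z \<in> \<real>"
proof -
  obtain a where a: "z = of_real a" using assms(4) by (auto elim: Reals_cases)
  have "(F has_field_derivative deriv F z) (at z)"
    using assms by (auto intro: holomorphic_derivI)
  then have "((\<lambda>t. F (of_real t)) has_vector_derivative deriv F z) (at a)"
    unfolding a by (rule has_vector_derivative_real_field)
  then have "((\<lambda>t. Im (F (of_real t))) has_vector_derivative Im (deriv F z)) (at a)"
    by (rule bounded_linear.has_vector_derivative[OF bounded_linear_Im])
  moreover have "eventually (\<lambda>t. Im (F (of_real t)) = 0) (nhds a)"
  proof -
    have "open (of_real -` \<Omega> :: real set)"
      using assms(2) by (intro open_vimage continuous_intros)
    then have "eventually (\<lambda>t. t \<in> of_real -` \<Omega>) (nhds a)"
      using assms(4) a by (intro eventually_nhds_in_open) auto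
    then show ?thesis
      by eventually_elim (use assms(3) in \<open>auto simp: complex_is_Real_iff\<close>)
  qed
  ultimately have "((\<lambda>t. 0) has_vector_derivative Im (deriv F z)) (at a)"
    unfolding has_real_derivative_iff_has_vector_derivative[symmetric]
    by (subst (asm) DERIV_cong_ev[OF refl _ refl]) auto
  then have "Im (deriv F z) = 0"
    using has_vector_derivative_const vector_derivative_unique_at by metis
  then show ?thesis by (simp add: complex_is_Real_iff)
qed

lemma higher_deriv_in_Reals:
  assumes "F holomorphic_on \<Omega>" "open \<Omega>" "\<And>z. z \<in> \<Omega> \<inter> \<real> \<Longrightarrow> F z \<in> \<real>" "z \<in> \<Omega> \<inter> \<real>"
  shows "(deriv ^^ n) F z \<in> \<real>"
  using assms(4)
proof (induction n arbitrary: z)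
  case (Suc n)
  have "deriv ((deriv ^^ n) F) z \<in> \<real>"
    by (rule deriv_in_Reals[OF holomorphic_higher_deriv[OF assms(1,2)] assms(2) Suc.IH Suc.prems])
  then show ?case by simp
qed (use assms in auto)

section \<open>Split-analytic functions from pairs of complex functions\<close>

lemma split_analytic_at_bc_fun:
  assumes F: "F1 holomorphic_on \<Omega>1" "F2 holomorphic_on \<Omega>2" and op: "open \<Omega>1" "open \<Omega>2"
    and re: "\<And>z. z \<in> \<Omega>1 \<inter> \<real> \<Longrightarrow> F1 z \<in> \<real>" "\<And>z. z \<in> \<Omega>2 \<inter> \<real> \<Longrightarrow> F2 z \<in> \<real>"
    and p: "p \<in> bc_domain \<Omega>1 \<Omega>2 \<inter> split_complex"
  shows "split_analytic_at (bc_fun F1 F2) p"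
proof -
  let ?a = "idem1 p" and ?b = "idem2 p"
  have ab: "?a \<in> \<Omega>1 \<inter> \<real>" "?b \<in> \<Omega>2 \<inter> \<real>"
    using p by (auto simp: mem_bc_domain_iff mem_split_complex_iff)
  obtain r1 r2 where r: "r1 > 0" "ball ?a r1 \<subseteq> \<Omega>1" "r2 > 0" "ball ?b r2 \<subseteq> \<Omega>2"
    using op ab by (meson IntD1 open_contains_ball)
  \<comment> \<open>Powers act coordinatewise, so pairing the two Taylor coefficients merges two
    complex series into one split-complex series.\<close>
  define c where "c n = bc_idem ((deriv ^^ n) F1 ?a / fact n) ((deriv ^^ n) F2 ?b / fact n)" for n
  have "c n \<in> split_complex" for n
    using higher_deriv_in_Reals[OF F(1) op(1) re(1) ab(1), of n]
      higher_deriv_in_Reals[OF F(2) op(2) re(2) ab(2), of n]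
    by (auto simp: c_def mem_split_complex_iff intro!: Reals_divide fact_in_Reals)
  moreover have "(\<lambda>n. c n * (q - p) ^ n) sums bc_fun F1 F2 q" if "dist q p < min r1 r2 / 2" for q
  proof -
    have "idem1 q \<in> ball ?a r1" "idem2 q \<in> ball ?b r2"
      using that dist_idem_le[of q p] by (auto simp: dist_commute)
    then have "(\<lambda>n. (deriv ^^ n) F1 ?a / fact n * (idem1 q - ?a) ^ n) sums F1 (idem1 q)"
      "(\<lambda>n. (deriv ^^ n) F2 ?b / fact n * (idem2 q - ?b) ^ n) sums F2 (idem2 q)"
      using holomorphic_power_series[OF holomorphic_on_subset[OF F(1) r(2)]]
        holomorphic_power_series[OF holomorphic_on_subset[OF F(2) r(4)]] by auto
    from sums_add[OF bounded_linear.sums[OF bounded_linear_bc_idem(1) this(1)]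
        bounded_linear.sums[OF bounded_linear_bc_idem(2) this(2)]]
    have "(\<lambda>n. bc_idem ((deriv ^^ n) F1 ?a / fact n * (idem1 q - ?a) ^ n)
        ((deriv ^^ n) F2 ?b / fact n * (idem2 q - ?b) ^ n)) sums bc_fun F1 F2 q"
      by (simp add: bc_idem_conv_add[symmetric] bc_fun_def)
    moreover have "c n * (q - p) ^ n = bc_idem ((deriv ^^ n) F1 ?a / fact n * (idem1 q - ?a) ^ n)
        ((deriv ^^ n) F2 ?b / fact n * (idem2 q - ?b) ^ n)" for n
      by (rule idem_eqI) (simp_all add: c_def)
    ultimately show ?thesis by simp
  qed
  ultimately show ?thesis
    unfolding split_analytic_at_def using r by (intro exI[of _ c] exI[of _ "min r1 r2 / 2"]) auto
qed

lemma split_analytic_at_cong: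
  assumes "split_analytic_at F p" "e > 0"
    and "\<And>q. q \<in> split_complex \<Longrightarrow> dist q p < e \<Longrightarrow> F q = G q"
  shows "split_analytic_at G p"
proof -
  obtain a r where "r > 0" "\<forall>n. a n \<in> split_complex"
    "\<forall>q \<in> split_complex. dist q p < r \<longrightarrow> (\<lambda>n. a n * (q - p) ^ n) sums F q"
    using assms(1) by (auto simp: split_analytic_at_def)
  then show ?thesis
    unfolding split_analytic_at_def using assms(2,3)
    by (intro exI[of _ a] exI[of _ "min r e"]) auto
qed

lemma split_complex_translate: "p \<in> split_complex \<Longrightarrow> p + t *\<^sub>R 1 \<in> split_complex"
  by (simp add: mem_split_complex_iff scaleR_conv_of_real)

text \<open>The real translates \<open>p + t\<close> move both idempotent components at once, so for small
  \<open>t > 0\<close> they avoid exceptional points of either component.\<close>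

lemma split_analytic_at_tendsto:
  assumes "split_analytic_at F p" "p \<in> split_complex"
  shows "((\<lambda>t. F (p + t *\<^sub>R 1)) \<longlongrightarrow> F p) (at_right 0)"
proof -
  obtain a r where r: "r > 0"
    and sums: "\<And>q. q \<in> split_complex \<Longrightarrow> dist q p < r \<Longrightarrow> (\<lambda>n. a n * (q - p) ^ n) sums F q"
    using assms(1) by (auto simp: split_analytic_at_def)
  \<comment> \<open>For \<open>0 \<le> t < s\<close> the translate of \<open>p\<close> by
    \<open>t\<close> stays within distance \<open>r\<close>, whatever the norm of 1 is.\<close>
  define s where "s = r / (norm (1::bicomplex) + 1)"
  have s: "s > 0" "t * norm (1::bicomplex) < r" if "0 \<le> t" "t < s" for t
  proof -
    have "t * norm (1::bicomplex) \<le> t * (norm (1::bicomplex) + 1)"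
      using that by (simp add: algebra_simps)
    also have "\<dots> < r"
      using that by (simp add: s_def pos_less_divide_eq add_nonneg_pos)
    finally show "s > 0" "t * norm (1::bicomplex) < r"
      using that by auto
  qed
  have "s > 0" using r by (simp add: s_def add_nonneg_pos)
  have *: "(\<lambda>n. a n * (t *\<^sub>R 1) ^ n) sums F (p + t *\<^sub>R 1)" if "0 \<le> t" "t < s" for t
    using sums[of "p + t *\<^sub>R 1"] split_complex_translate[OF assms(2)] s(2)[OF that] that
    by (simp add: dist_norm)
  \<comment> \<open>A coordinate \<open>f\<close> turns the bicomplex series into a complex power
    series in \<open>t\<close>; the second premise records that \<open>idem1\<close> and
    \<open>idem2\<close> are multiplicative on its terms.\<close>
  have lim: "((\<lambda>t. f (F (p + t *\<^sub>R 1))) \<longlongrightarrow> f (F p)) (at_right 0)"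
    if f: "bounded_linear f" "\<And>n t. f (a n * (t *\<^sub>R 1) ^ n) = f (a n) * of_real t ^ n"
    for f :: "bicomplex \<Rightarrow> complex"
  proof -
    have fs: "(\<lambda>n. f (a n) * of_real t ^ n) sums f (F (p + t *\<^sub>R 1))" if "0 \<le> t" "t < s" for t
      using bounded_linear.sums[OF f(1) *[OF that]] by (simp only: f(2))
    define P where "P z = (\<Sum>n. f (a n) * z ^ n)" for z
    \<comment> \<open>Convergence is known only at real arguments; convergence at \<open>s/2\<close>
      extends it to the complex disc of that radius, so the constant term is the limit at 0.\<close>
    have "(\<lambda>n. f (a n) * z ^ n) sums P z" if "norm z < s / 2" for z
      unfolding P_def
      by (rule summable_sums, rule powser_inside[of _ "of_real (s/2)"])
        (use fs[of "s/2"] that \<open>s > 0\<close> in \<open>auto simp: sums_iff\<close>)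
    then have "(P \<longlongrightarrow> f (a 0)) (at 0)"
      by (intro powser_limit_0[of "s / 2" "\<lambda>n. f (a n)"]) (use \<open>s > 0\<close> in auto)
    moreover have "filterlim (of_real :: real \<Rightarrow> complex) (at 0) (at_right 0)"
      unfolding filterlim_at
      by (auto intro!: tendsto_eq_intros simp: eventually_at_filter)
    ultimately have "((\<lambda>t. P (of_real t)) \<longlongrightarrow> f (a 0)) (at_right 0)"
      by (rule filterlim_compose)
    moreover have "eventually (\<lambda>t. P (of_real t) = f (F (p + t *\<^sub>R 1))) (at_right 0)"
      unfolding eventually_at_right_field
      by (rule exI[of _ s]) (use fs \<open>s > 0\<close> in \<open>auto simp: P_def sums_iff\<close>)
    moreover have "f (a 0) = f (F p)"
      using sums_unique2[OF powser_sums_zero[of "\<lambda>n. f (a n)"], of "f (F p)"] fs[of 0] \<open>s > 0\<close>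
      by simp
    ultimately show ?thesis
      by (simp add: tendsto_cong)
  qed
  have "((\<lambda>t. bc_idem (idem1 (F (p + t *\<^sub>R 1))) 0 + bc_idem 0 (idem2 (F (p + t *\<^sub>R 1))))
      \<longlongrightarrow> bc_idem (idem1 (F p)) 0 + bc_idem 0 (idem2 (F p))) (at_right 0)"
    by (intro tendsto_add bounded_linear.tendsto[OF bounded_linear_bc_idem(1)]
        bounded_linear.tendsto[OF bounded_linear_bc_idem(2)] lim bounded_linear_idem)
      (simp_all add: scaleR_conv_of_real)
  then show ?thesis
    by (simp add: bc_idem_conv_add[symmetric])
qed

text \<open>By \<open>ev\<close>, each \<open>h\<close> differs from its \<open>H\<close> at
  isolated points only. Small positive real translates of any point avoid these in both coordinates;
  this gives density, and it gives agreement at the point itself by passing to the limit.\<close>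

lemma split_extends_bc_fun:
  assumes H: "H1 holomorphic_on \<Omega>1" "H2 holomorphic_on \<Omega>2" and op: "open \<Omega>1" "open \<Omega>2"
    and re: "\<And>z. z \<in> \<Omega>1 \<inter> \<real> \<Longrightarrow> H1 z \<in> \<real>" "\<And>z. z \<in> \<Omega>2 \<inter> \<real> \<Longrightarrow> H2 z \<in> \<real>"
    and ev: "\<And>z. z \<in> \<Omega>1 \<Longrightarrow> eventually (\<lambda>w. h1 w = H1 w) (at z)"
      "\<And>z. z \<in> \<Omega>2 \<Longrightarrow> eventually (\<lambda>w. h2 w = H2 w) (at z)"
  shows "split_extends (bc_fun H1 H2) (bc_fun h1 h2) (bc_domain \<Omega>1 \<Omega>2 \<inter> split_complex)"
proof -
  let ?S = "bc_domain \<Omega>1 \<Omega>2 \<inter> split_complex"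
  have hol: "split_analytic_at (bc_fun H1 H2) p" if "p \<in> ?S" for p
    using split_analytic_at_bc_fun[OF H op re that] by blast
  have near: "eventually (\<lambda>t. p + t *\<^sub>R 1 \<in> ?S \<and> split_analytic_at (bc_fun h1 h2) (p + t *\<^sub>R 1) \<and>
      bc_fun h1 h2 (p + t *\<^sub>R 1) = bc_fun H1 H2 (p + t *\<^sub>R 1)) (at_right 0)" if p: "p \<in> ?S" for p
  proof -
    have ab: "idem1 p \<in> \<Omega>1" "idem2 p \<in> \<Omega>2" using p by (auto simp: mem_bc_domain_iff)
    have "eventually (\<lambda>w. w \<in> \<Omega>1 \<and> h1 w = H1 w) (at (idem1 p))"
      "eventually (\<lambda>w. w \<in> \<Omega>2 \<and> h2 w = H2 w) (at (idem2 p))"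
      using ev ab op by (auto intro!: eventually_conj eventually_at_in_open')
    then obtain e1 e2 where e: "e1 > 0" "\<And>w. w \<noteq> idem1 p \<Longrightarrow> dist w (idem1 p) < e1 \<Longrightarrow> w \<in> \<Omega>1 \<and> h1 w = H1 w"
      "e2 > 0" "\<And>w. w \<noteq> idem2 p \<Longrightarrow> dist w (idem2 p) < e2 \<Longrightarrow> w \<in> \<Omega>2 \<and> h2 w = H2 w"
      unfolding eventually_at by (metis UNIV_I)
    define e where "e = min e1 e2"
    have "e > 0" using e by (simp add: e_def)
    have "p + t *\<^sub>R 1 \<in> ?S \<and> split_analytic_at (bc_fun h1 h2) (p + t *\<^sub>R 1) \<and>
      bc_fun h1 h2 (p + t *\<^sub>R 1) = bc_fun H1 H2 (p + t *\<^sub>R 1)" if t: "0 < t" "t < e" for t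
    proof -
      let ?q = "p + t *\<^sub>R 1"
      have d: "dist (idem1 ?q) (idem1 p) = t" "dist (idem2 ?q) (idem2 p) = t"
        using t by (auto simp: dist_norm)
      have q: "?q \<in> ?S"
        using d t e split_complex_translate p by (fastforce simp: mem_bc_domain_iff e_def)
      \<comment> \<open>The coordinates of \<open>?q\<close> lie at distance exactly
        \<open>t\<close> from those of \<open>p\<close>. Those of \<open>x\<close> are closer than
        \<open>min t (e - t)\<close> to them, so their distance from \<open>p\<close> stays strictly
        between 0 and \<open>e\<close>.\<close>
      have eq: "bc_fun H1 H2 x = bc_fun h1 h2 x" if x: "dist x ?q < min t (e - t) / 2" for x
      proof -
        have "dist (idem1 x) (idem1 ?q) < min t (e - t)" "dist (idem2 x) (idem2 ?q) < min t (e - t)"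
          using dist_idem_le[of x ?q] x by auto
        moreover have "dist (idem1 x) (idem1 p) \<le> dist (idem1 x) (idem1 ?q) + t"
          "dist (idem2 x) (idem2 p) \<le> dist (idem2 x) (idem2 ?q) + t"
          "t \<le> dist (idem1 x) (idem1 ?q) + dist (idem1 x) (idem1 p)"
          "t \<le> dist (idem2 x) (idem2 ?q) + dist (idem2 x) (idem2 p)"
          using dist_triangle[of "idem1 x" "idem1 p" "idem1 ?q"]
            dist_triangle[of "idem2 x" "idem2 p" "idem2 ?q"]
            dist_triangle3[of "idem1 ?q" "idem1 p" "idem1 x"]
            dist_triangle3[of "idem2 ?q" "idem2 p" "idem2 x"] d by linarith+
        ultimately have "dist (idem1 x) (idem1 p) < e" "dist (idem2 x) (idem2 p) < e"
          "idem1 x \<noteq> idem1 p" "idem2 x \<noteq> idem2 p" by auto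
        then show ?thesis using e by (simp add: bc_fun_def e_def)
      qed
      have "split_analytic_at (bc_fun h1 h2) ?q"
        by (rule split_analytic_at_cong[OF hol[OF q], of "min t (e - t) / 2"]) (use eq t in auto)
      moreover have "bc_fun h1 h2 ?q = bc_fun H1 H2 ?q"
        by (rule eq[symmetric]) (use t in auto)
      ultimately show ?thesis using q by blast
    qed
    then show ?thesis
      unfolding eventually_at_right_field using \<open>e > 0\<close> by blast
  qed
  have lim: "((\<lambda>t. p + t *\<^sub>R 1) \<longlongrightarrow> p) (at_right 0)" for p :: bicomplex
    by (auto intro!: tendsto_eq_intros)
  have "p \<in> closure {q \<in> ?S. split_analytic_at (bc_fun h1 h2) q}" if "p \<in> ?S" for p
    by (rule Lim_in_closed_set[OF closed_closure _ _ lim])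
      (auto intro: eventually_mono[OF near[OF that]] subsetD[OF closure_subset])
  \<comment> \<open>Both values are right limits along the same translates, on which the two
    functions agree.\<close>
  moreover have "bc_fun H1 H2 p = bc_fun h1 h2 p"
    if "p \<in> ?S" "split_analytic_at (bc_fun h1 h2) p" for p
  proof -
    have "((\<lambda>t. bc_fun H1 H2 (p + t *\<^sub>R 1)) \<longlongrightarrow> bc_fun H1 H2 p) (at_right 0)"
      using split_analytic_at_tendsto[OF hol] that by blast
    moreover have "((\<lambda>t. bc_fun h1 h2 (p + t *\<^sub>R 1)) \<longlongrightarrow> bc_fun h1 h2 p) (at_right 0)"
      using split_analytic_at_tendsto that by blast
    then have "((\<lambda>t. bc_fun H1 H2 (p + t *\<^sub>R 1)) \<longlongrightarrow> bc_fun h1 h2 p) (at_right 0)"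
      by (rule Lim_transform_eventually) (auto intro: eventually_mono[OF near[OF that(1)]])
    ultimately show ?thesis
      using tendsto_unique trivial_limit_at_right_real by blast
  qed
  ultimately show ?thesis
    unfolding split_extends_def split_holomorphic_on_def using hol by blast
qed

section \<open>The Weierstrass form of a maximal surface\<close>

text \<open>Only \<open>f\<close> and \<open>f g^2\<close> are assumed holomorphic; the middle
  product is controlled by \<open>(g f)^2 = f * (f g^2)\<close>. Its right side has a finite limit,
  so the meromorphic function \<open>g f\<close> cannot have a pole.\<close>

lemma weierstrass_products_tendsto:
  assumes f: "f holomorphic_on \<Omega>" and g: "g meromorphic_on \<Omega>" and op: "open \<Omega>" and z: "z \<in> \<Omega>"
    and hol: "remove_sings (\<lambda>z. f z * (g z)\<^sup>2) holomorphic_on \<Omega>"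
  obtains c d where "((\<lambda>w. f w * (g w)\<^sup>2) \<longlongrightarrow> c) (at z)" "((\<lambda>w. g w * f w) \<longlongrightarrow> d) (at z)"
proof -
  let ?h = "\<lambda>z. f z * (g z)\<^sup>2"
  have fm: "f meromorphic_on \<Omega>"
    using f op by (simp add: analytic_on_imp_meromorphic_on analytic_on_open)
  have gf: "(\<lambda>w. g w * f w) meromorphic_on {z}" "?h meromorphic_on {z}"
    using fm g z by (auto intro!: meromorphic_intros intro: meromorphic_on_subset)
  \<comment> \<open>Near \<open>z\<close>, but off \<open>z\<close>, \<open>remove_sings ?h\<close>
    agrees with \<open>?h\<close>; its continuity therefore also excludes a pole of
    \<open>?h\<close>.\<close>
  have "isCont (remove_sings ?h) z"
    using hol op z by (meson continuous_on_eq_continuous_at holomorphic_on_imp_continuous_on)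
  then have h: "(?h \<longlongrightarrow> remove_sings ?h z) (at z)"
    using gf(2) by (simp add: isCont_def meromorphic_at_iff)
  have "isCont f z"
    using f op z by (meson continuous_on_eq_continuous_at holomorphic_on_imp_continuous_on)
  then have "((\<lambda>w. (g w * f w)\<^sup>2) \<longlongrightarrow> f z * remove_sings ?h z) (at z)"
    using tendsto_mult[OF _ h] by (simp add: isCont_def power2_eq_square mult_ac)
  moreover have "filterlim (\<lambda>w. (g w * f w)\<^sup>2) at_infinity (at z)" if "is_pole (\<lambda>w. g w * f w) z"
    using that unfolding is_pole_def by (intro Limits.filterlim_power_at_infinity) auto
  ultimately have "\<not> is_pole (\<lambda>w. g w * f w) z"
    using not_tendsto_and_filterlim_at_infinity at_neq_bot by blast
  then show ?thesis
    using that h gf(1) by (auto simp: meromorphic_at_iff not_essential_def)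
qed

context
  fixes \<Omega> X g f
  assumes surf: "maximal_surface_data \<Omega> X g f"
begin

lemma maximal_surface_open: "open \<Omega>"
  using surf by (simp add: maximal_surface_data_def)

lemma weierstrass_vec_meromorphic:
  "(\<lambda>z. weierstrass_vec (g z) (f z) $ i) meromorphic_on \<Omega>"
proof -
  have "g meromorphic_on \<Omega>" "f meromorphic_on \<Omega>"
    using surf by (auto simp: maximal_surface_data_def nicely_meromorphic_on_def
        analytic_on_imp_meromorphic_on analytic_on_open)
  then show ?thesis
    using exhaust_3[of i] by (auto simp: weierstrass_vec_def intro!: meromorphic_intros)
qed

lemma weierstrass_vec_tendsto_form:
  assumes "z \<in> \<Omega>"
  shows "((\<lambda>z. weierstrass_vec (g z) (f z) $ i) \<longlongrightarrow> weierstrass_form g f i z) (at z)"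
proof -
  obtain c d where cd: "((\<lambda>w. f w * (g w)\<^sup>2) \<longlongrightarrow> c) (at z)" "((\<lambda>w. g w * f w) \<longlongrightarrow> d) (at z)"
    by (rule weierstrass_products_tendsto[of f \<Omega> g z])
      (use surf assms in \<open>auto simp: maximal_surface_data_def nicely_meromorphic_on_def\<close>)
  have fz: "(f \<longlongrightarrow> f z) (at z)"
    using surf assms unfolding maximal_surface_data_def
    by (metis continuous_on_eq_continuous_at holomorphic_on_imp_continuous_on isCont_def)
  have "\<exists>l. ((\<lambda>z. weierstrass_vec (g z) (f z) $ i) \<longlongrightarrow> l) (at z)"
    using exhaust_3[of i] tendsto_diff[OF fz cd(1)] tendsto_mult_left[OF cd(2), of 2]
      tendsto_add[OF fz cd(1)]
    by (auto simp: weierstrass_vec_def algebra_simps)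
  then show ?thesis
    unfolding weierstrass_form_def using remove_sings_eqI by blast
qed

lemma eventually_weierstrass_form_eq:
  assumes "z \<in> \<Omega>"
  shows "eventually (\<lambda>w. weierstrass_vec (g w) (f w) $ i = weierstrass_form g f i w) (at z)"
proof -
  have "isolated_singularity_at (\<lambda>z. weierstrass_vec (g z) (f z) $ i) z"
    using weierstrass_vec_meromorphic assms by (auto simp: meromorphic_on_altdef)
  then show ?thesis
    unfolding weierstrass_form_def
    by (intro eventually_mono[OF eventually_remove_sings_eq_at]) auto
qed

lemma weierstrass_form_holomorphic: "weierstrass_form g f i holomorphic_on \<Omega>"
proof -
  have "weierstrass_form g f i analytic_on {z}" if "z \<in> \<Omega>" for z
    unfolding weierstrass_form_def
    by (rule remove_sings_analytic_at[OF _ weierstrass_vec_tendsto_form[OF that]])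
      (use weierstrass_vec_meromorphic that in \<open>auto simp: meromorphic_on_altdef\<close>)
  then show ?thesis
    using analytic_on_analytic_at analytic_imp_holomorphic by blast
qed

text \<open>The identity \<open>(1 - g^2)^2 + (2 g)^2 = (1 + g^2)^2\<close> holds for the raw
  components, and the limit carries it to the filled-in values at poles of \<open>g\<close>.\<close>

lemma weierstrass_form_null:
  assumes "z \<in> \<Omega>"
  shows "(weierstrass_form g f 1 z)\<^sup>2 + (weierstrass_form g f 2 z)\<^sup>2 - (weierstrass_form g f 3 z)\<^sup>2 = 0"
proof -
  let ?v = "\<lambda>w. weierstrass_vec (g w) (f w)"
  have "(\<lambda>w. (?v w $ 1)\<^sup>2 + (?v w $ 2)\<^sup>2 - (?v w $ 3)\<^sup>2) = (\<lambda>w. 0)"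
    by (simp add: weierstrass_vec_def power2_eq_square algebra_simps)
  moreover have "((\<lambda>w. (?v w $ 1)\<^sup>2 + (?v w $ 2)\<^sup>2 - (?v w $ 3)\<^sup>2) \<longlongrightarrow>
     (weierstrass_form g f 1 z)\<^sup>2 + (weierstrass_form g f 2 z)\<^sup>2 - (weierstrass_form g f 3 z)\<^sup>2) (at z)"
    by (intro tendsto_intros weierstrass_vec_tendsto_form assms)
  ultimately show ?thesis
    using LIM_unique by fastforce
qed

text \<open>At a pole of \<open>g\<close> the value of the form is a limit. Approaching along the
  real axis suffices, because the reals are closed.\<close>

lemma weierstrass_form_real:
  assumes re: "\<And>z. z \<in> \<Omega> \<inter> \<real> \<Longrightarrow> g z \<in> \<real>" "\<And>z. z \<in> \<Omega> \<inter> \<real> \<Longrightarrow> f z \<in> \<real>" and z: "z \<in> \<Omega> \<inter> \<real>"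
  shows "weierstrass_form g f i z \<in> \<real>"
proof -
  let ?v = "\<lambda>w. weierstrass_vec (g w) (f w) $ i"
  obtain a where a: "z = of_real a" using z by (auto elim: Reals_cases)
  have of_real: "filterlim of_real (at z) (at a)"
    unfolding a filterlim_at by (auto intro!: tendsto_eq_intros simp: eventually_at_filter)
  have "((\<lambda>t. ?v (of_real t)) \<longlongrightarrow> weierstrass_form g f i z) (at a)"
    by (rule filterlim_compose[OF weierstrass_vec_tendsto_form of_real]) (use z in auto)
  moreover have "eventually (\<lambda>t. ?v (of_real t) \<in> \<real>) (at a)"
  proof -
    have "open (of_real -` \<Omega> :: real set)"
      using maximal_surface_open by (intro open_vimage continuous_intros)
    then have "eventually (\<lambda>t. t \<in> of_real -` \<Omega>) (at a)"
      using z a by (intro eventually_at_in_open') auto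
    then show ?thesis
    proof eventually_elim
      case (elim t)
      then show ?case
        using exhaust_3[of i] re[of "of_real t"]
        by (auto simp: weierstrass_vec_def intro!: Reals_mult Reals_add Reals_diff Reals_power)
    qed
  qed
  ultimately show ?thesis
    by (intro Lim_in_closed_set[OF closed_complex_Reals]) auto
qed

text \<open>The integral formula for \<open>X\<close> refers to one base point per component.
  Prepending a path from that base point to \<open>\<gamma>\<close> and subtracting frees it from
  this choice.\<close>

lemma maximal_surface_increment:
  assumes \<gamma>: "valid_path \<gamma>" "path_image \<gamma> \<subseteq> \<Omega>"
  shows "X (pathfinish \<gamma>) $ i - X (pathstart \<gamma>) $ i = Re (contour_integral \<gamma> (weierstrass_form g f i))"
proof -
  define C where "C = connected_component_set \<Omega> (pathstart \<gamma>)"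
  have ps: "pathstart \<gamma> \<in> \<Omega>" using \<gamma>(2) pathstart_in_path_image by blast
  have C: "C \<in> components \<Omega>" using ps by (simp add: C_def componentsI)
  have "path_image \<gamma> \<subseteq> C"
    unfolding C_def using \<gamma> by (intro connected_component_maximal connected_valid_path_image) auto
  then have in_C: "pathstart \<gamma> \<in> C" "pathfinish \<gamma> \<in> C" by auto
  obtain z0 where z0: "z0 \<in> C" "\<And>z \<gamma> i. z \<in> C \<Longrightarrow> valid_path \<gamma> \<Longrightarrow> path_image \<gamma> \<subseteq> \<Omega> \<Longrightarrow>
      pathstart \<gamma> = z0 \<Longrightarrow> pathfinish \<gamma> = z \<Longrightarrow>
      X z $ i = Re (contour_integral \<gamma> (weierstrass_form g f i))"
    using surf C unfolding maximal_surface_data_def by meson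
  have "open C" "connected C" "C \<subseteq> \<Omega>"
    using C maximal_surface_open by (auto simp: open_components in_components_connected in_components_subset)
  then obtain \<delta> where \<delta>: "polynomial_function \<delta>" "path_image \<delta> \<subseteq> C" "pathstart \<delta> = z0"
      "pathfinish \<delta> = pathstart \<gamma>"
    using connected_open_polynomial_connected[of C] z0(1) in_C(1) by metis
  have \<delta>': "valid_path \<delta>" "path_image \<delta> \<subseteq> \<Omega>"
    using \<delta> \<open>C \<subseteq> \<Omega>\<close> by (auto simp: valid_path_polynomial_function)
  have int: "weierstrass_form g f i contour_integrable_on \<delta>" "weierstrass_form g f i contour_integrable_on \<gamma>"
    using contour_integrable_holomorphic_simple[OF weierstrass_form_holomorphic maximal_surface_open]
      \<gamma> \<delta>' by auto
  have "X (pathfinish \<gamma>) $ i = Re (contour_integral (\<delta> +++ \<gamma>) (weierstrass_form g f i))"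
    by (rule z0(2)) (use \<gamma> \<delta> \<delta>' in_C in \<open>auto simp: path_image_join\<close>)
  moreover have "X (pathstart \<gamma>) $ i = Re (contour_integral \<delta> (weierstrass_form g f i))"
    by (rule z0(2)) (use \<delta> \<delta>' in_C in auto)
  ultimately show ?thesis
    using int \<gamma> \<delta>' \<delta>(4) by simp
qed

text \<open>On a disc the form has a primitive \<open>W\<close>, and integration along straight
  segments shows that each component of \<open>X\<close> is a constant plus \<open>Re W\<close> on a
  real interval.\<close>

lemma maximal_surface_has_real_derivative:
  assumes "of_real a \<in> \<Omega>"
  shows "((\<lambda>t. X (of_real t) $ i) has_real_derivative Re (weierstrass_form g f i (of_real a))) (at a)"
proof -
  let ?w = "weierstrass_form g f i"
  obtain r where r: "r > 0" "ball (of_real a) r \<subseteq> \<Omega>"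
    using assms maximal_surface_open by (meson open_contains_ball)
  have "?w holomorphic_on ball (of_real a) r"
    using weierstrass_form_holomorphic r holomorphic_on_subset by blast
  then obtain W where W: "\<And>z. z \<in> ball (of_real a) r \<Longrightarrow> (W has_field_derivative ?w z) (at z)"
    using holomorphic_convex_primitive'[of "ball (of_real a) r" ?w] 
    by (auto simp: at_within_open_NO_MATCH)
  have eq: "X (of_real t) $ i = X (of_real a) $ i - Re (W (of_real a)) + Re (W (of_real t))"
    if "t \<in> ball a r" for t
  proof -
    let ?l = "linepath (of_real a) (of_real t :: complex)"
    have t: "of_real t \<in> ball (of_real a :: complex) r"
      using that by (simp add: dist_of_real)
    have l: "path_image ?l \<subseteq> ball (of_real a) r"
      using t r by (simp add: closed_segment_subset)
    have "(?w has_contour_integral (W (pathfinish ?l) - W (pathstart ?l))) ?l"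
      by (rule contour_integral_primitive[of "ball (of_real a) r"])
        (use W l in \<open>auto intro: has_field_derivative_at_within\<close>)
    then have "X (of_real t) $ i - X (of_real a) $ i = Re (W (of_real t) - W (of_real a))"
      using maximal_surface_increment[of ?l i] l r by (simp add: contour_integral_unique)
    then show ?thesis by simp
  qed
  have "((\<lambda>t. W (of_real t)) has_vector_derivative ?w (of_real a)) (at a)"
    using W[of "of_real a"] r by (intro has_vector_derivative_real_field) auto
  then have "((\<lambda>t. Re (W (of_real t))) has_real_derivative Re (?w (of_real a))) (at a)"
    unfolding has_real_derivative_iff_has_vector_derivative
    by (rule bounded_linear.has_vector_derivative[OF bounded_linear_Re])
  from DERIV_add[OF DERIV_const this] have "((\<lambda>t. X (of_real a) $ i - Re (W (of_real a)) + Re (W (of_real t))) has_real_derivative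
      Re (?w (of_real a))) (at a)"
    by simp
  then show ?thesis
    by (rule has_field_derivative_transform_within_open[of _ _ _ "ball a r"])
      (simp_all only: eq[symmetric] open_ball centre_in_ball r(1))
qed

end

lemma split_contour_integral_bc_fun:
  assumes W: "W1 holomorphic_on \<Omega>1" "W2 holomorphic_on \<Omega>2" and op: "open \<Omega>1" "open \<Omega>2"
    and \<gamma>: "valid_path \<gamma>" "path_image \<gamma> \<subseteq> bc_domain \<Omega>1 \<Omega>2"
  shows "split_contour_integral \<gamma> (bc_fun W1 W2) =
    bc_idem (contour_integral (idem1 \<circ> \<gamma>) W1) (contour_integral (idem2 \<circ> \<gamma>) W2)"
proof -
  let ?\<gamma>1 = "idem1 \<circ> \<gamma>" and ?\<gamma>2 = "idem2 \<circ> \<gamma>"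
  let ?D = "\<lambda>g t. vector_derivative g (at t within {0..1})"
  have "valid_path ?\<gamma>1" "valid_path ?\<gamma>2"
    using \<gamma>(1) linear_idem by (auto intro: linear_image_valid_path)
  moreover have "path_image ?\<gamma>1 \<subseteq> \<Omega>1" "path_image ?\<gamma>2 \<subseteq> \<Omega>2"
    using \<gamma>(2) by (auto simp: path_image_def mem_bc_domain_iff)
  ultimately have "W1 contour_integrable_on ?\<gamma>1" "W2 contour_integrable_on ?\<gamma>2"
    using W op contour_integrable_holomorphic_simple by blast+
  then have "((\<lambda>t. W1 (?\<gamma>1 t) * ?D ?\<gamma>1 t) has_integral contour_integral ?\<gamma>1 W1) {0..1}"
    "((\<lambda>t. W2 (?\<gamma>2 t) * ?D ?\<gamma>2 t) has_integral contour_integral ?\<gamma>2 W2) {0..1}"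
    by (auto dest!: has_contour_integral_integral simp: has_contour_integral_def)
  from has_integral_add[OF has_integral_linear[OF this(1) bounded_linear_bc_idem(1)]
      has_integral_linear[OF this(2) bounded_linear_bc_idem(2)]]
  have int: "((\<lambda>t. bc_idem (W1 (?\<gamma>1 t) * ?D ?\<gamma>1 t) (W2 (?\<gamma>2 t) * ?D ?\<gamma>2 t)) has_integral
      bc_idem (contour_integral ?\<gamma>1 W1) (contour_integral ?\<gamma>2 W2)) {0..1}"
    by (simp add: o_def bc_idem_conv_add[symmetric])
  \<comment> \<open>At finitely many parameters \<open>\<gamma>\<close> may lack a derivative, and
    there \<open>vector_derivative\<close> need not commute with the coordinates; the integral
    ignores these points.\<close>
  obtain S where S: "finite S" "\<gamma> C1_differentiable_on {0..1} - S"
    using \<gamma>(1) by (auto simp: valid_path_def piecewise_C1_differentiable_on_def)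
  have "((\<lambda>t. bc_fun W1 W2 (\<gamma> t) * ?D \<gamma> t) has_integral
      bc_idem (contour_integral ?\<gamma>1 W1) (contour_integral ?\<gamma>2 W2)) {0..1}"
  proof (rule has_integral_spike_finite[OF S(1) _ int])
    fix t assume t: "t \<in> {0..1} - S"
    obtain D where D: "(\<gamma> has_vector_derivative D) (at t within {0..1})"
      using S(2) t unfolding C1_differentiable_on_def by (metis has_vector_derivative_at_within)
    have "?D \<gamma> t = D" "?D ?\<gamma>1 t = idem1 D" "?D ?\<gamma>2 t = idem2 D"
      using t bounded_linear.has_vector_derivative[OF bounded_linear_idem(1) D]
        bounded_linear.has_vector_derivative[OF bounded_linear_idem(2) D] D
      by (auto intro!: vector_derivative_within_closed_interval simp: o_def)
    then show "bc_fun W1 W2 (\<gamma> t) * ?D \<gamma> t =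
        bc_idem (W1 (?\<gamma>1 t) * ?D ?\<gamma>1 t) (W2 (?\<gamma>2 t) * ?D ?\<gamma>2 t)"
      by (intro idem_eqI) (simp_all add: bc_fun_def)
  qed
  then show ?thesis
    unfolding split_contour_integral_def by (rule integral_unique)
qed

section \<open>Timelike minimal surfaces from null curves\<close>

lemma has_vector_derivative_vecI:
  fixes F :: "real \<Rightarrow> real^'n"
  assumes "\<And>i. ((\<lambda>t. F t $ i) has_real_derivative D $ i) (at a)"
  shows "(F has_vector_derivative D) (at a)"
  unfolding has_vector_derivative_def
proof (subst has_derivative_componentwise_within, intro ballI)
  fix b :: "real^'n" assume "b \<in> Basis"
  then obtain i where b: "b = axis i 1"
    by (auto simp: Basis_vec_def)
  show "((\<lambda>x. F x \<bullet> b) has_derivative (\<lambda>x. (x *\<^sub>R D) \<bullet> b)) (at a)"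
    using assms[of i] by (simp add: b inner_axis has_real_derivative_iff_has_vector_derivative has_vector_derivative_def)
qed

text \<open>Both partial derivatives are again a function of \<open>u + v\<close> plus a function of
  \<open>u - v\<close>, so the lemma can be reapplied to them; the spelling
  \<open>+ - \<beta>'\<close> keeps that shape.\<close>

lemma d_Alembert:
  fixes \<alpha> \<beta> \<alpha>' \<beta>' :: "real \<Rightarrow> real^3"
  assumes op: "open A" "open B"
    and d: "\<And>t. t \<in> A \<Longrightarrow> (\<alpha> has_vector_derivative \<alpha>' t) (at t)"
      "\<And>t. t \<in> B \<Longrightarrow> (\<beta> has_vector_derivative \<beta>' t) (at t)"
    and cont: "continuous_on A \<alpha>'" "continuous_on B \<beta>'"
    and U: "U = {(u, v). u + v \<in> A \<and> u - v \<in> B}"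
    and Y: "\<And>u v. (u, v) \<in> U \<Longrightarrow> Y (u, v) = \<alpha> (u + v) + \<beta> (u - v)"
  shows "C1_on U Y"
    and "\<And>u v. (u, v) \<in> U \<Longrightarrow> partial_u Y (u, v) = \<alpha>' (u + v) + \<beta>' (u - v)"
    and "\<And>u v. (u, v) \<in> U \<Longrightarrow> partial_v Y (u, v) = \<alpha>' (u + v) + - \<beta>' (u - v)"
proof -
  have du: "((\<lambda>t. Y (t, v)) has_vector_derivative \<alpha>' (u + v) + \<beta>' (u - v)) (at u)"
    and dv: "((\<lambda>t. Y (u, t)) has_vector_derivative \<alpha>' (u + v) + - \<beta>' (u - v)) (at v)"
    if uv: "(u, v) \<in> U" for u v
  proof -
    have ab: "(\<alpha> has_vector_derivative \<alpha>' (u + v)) (at (u + v))"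
      "(\<beta> has_vector_derivative \<beta>' (u - v)) (at (u - v))"
      using d uv by (auto simp: U)
    have "((\<lambda>t. \<alpha> (t + v) + \<beta> (t - v)) has_vector_derivative 1 *\<^sub>R \<alpha>' (u + v) + 1 *\<^sub>R \<beta>' (u - v)) (at u)"
      by (intro has_vector_derivative_add vector_diff_chain_at[of _ _ _ \<alpha>, unfolded o_def]
          vector_diff_chain_at[of _ _ _ \<beta>, unfolded o_def] ab) (auto intro!: derivative_eq_intros)
    \<comment> \<open>The formula for \<open>Y\<close> is known only on \<open>U\<close>; the slice
      of \<open>U\<close> through the point is open, which is enough for a derivative.\<close>
    then show "((\<lambda>t. Y (t, v)) has_vector_derivative \<alpha>' (u + v) + \<beta>' (u - v)) (at u)"
      unfolding scaleR_one scaleR_minus1_left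
      by (rule has_vector_derivative_transform_within_open[of _ _ _ "(\<lambda>t. t + v) -` A \<inter> (\<lambda>t. t - v) -` B"])
        (use uv op in \<open>auto simp: Y U intro!: open_Int open_vimage continuous_intros\<close>)
    have "((\<lambda>t. \<alpha> (u + t) + \<beta> (u - t)) has_vector_derivative 1 *\<^sub>R \<alpha>' (u + v) + (- 1) *\<^sub>R \<beta>' (u - v)) (at v)"
      by (intro has_vector_derivative_add vector_diff_chain_at[of _ _ _ \<alpha>, unfolded o_def]
          vector_diff_chain_at[of _ _ _ \<beta>, unfolded o_def] ab) (auto intro!: derivative_eq_intros)
    then show "((\<lambda>t. Y (u, t)) has_vector_derivative \<alpha>' (u + v) + - \<beta>' (u - v)) (at v)"
      unfolding scaleR_one scaleR_minus1_left
      by (rule has_vector_derivative_transform_within_open[of _ _ _ "(\<lambda>t. u + t) -` A \<inter> (\<lambda>t. u - t) -` B"])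
        (use uv op in \<open>auto simp: Y U intro!: open_Int open_vimage continuous_intros\<close>)
  qed
  show pu: "partial_u Y (u, v) = \<alpha>' (u + v) + \<beta>' (u - v)"
    and pv: "partial_v Y (u, v) = \<alpha>' (u + v) + - \<beta>' (u - v)" if "(u, v) \<in> U" for u v
    using du[OF that] dv[OF that] by (simp_all add: partial_u_def partial_v_def vector_derivative_at)
  have "continuous_on U (\<lambda>p. \<alpha>' (fst p + snd p))" "continuous_on U (\<lambda>p. \<beta>' (fst p - snd p))"
    by (rule continuous_on_compose2[OF cont(1)] continuous_on_compose2[OF cont(2)];
        auto simp: U intro!: continuous_intros)+
  then have c: "continuous_on U (\<lambda>p. \<alpha>' (fst p + snd p) + \<beta>' (fst p - snd p))"
    "continuous_on U (\<lambda>p. \<alpha>' (fst p + snd p) + - \<beta>' (fst p - snd p))"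
    by (simp_all add: continuous_on_add continuous_on_diff)
  have "continuous_on U (partial_u Y)" "continuous_on U (partial_v Y)"
    by (rule continuous_on_eq[OF c(1)] continuous_on_eq[OF c(2)]; auto simp: pu pv)+
  moreover have "(\<lambda>t. Y (t, snd p)) differentiable (at (fst p))" 
     "(\<lambda>t. Y (fst p, t)) differentiable (at (snd p))" if "p \<in> U" for p
    using that du[of "fst p" "snd p"] dv[of "fst p" "snd p"]
    by (auto simp: has_vector_derivative_def differentiable_def)
  ultimately show "C1_on U Y"
    by (auto simp: C1_on_def)
qed

section \<open>Null coordinates on the domain and the generating curves\<close>

lemma split_coords_bc_domain:
  "split_coords (bc_domain \<Omega>1 \<Omega>2 \<inter> split_complex) =
    {(u, v). u + v \<in> of_real -` \<Omega>1 \<and> u - v \<in> of_real -` \<Omega>2}"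
  by (auto simp: split_coords_def mem_bc_domain_iff idem_split_of split_complex_def)

lemma split_open_bc_domain:
  assumes "open \<Omega>1" "open \<Omega>2"
  shows "split_open (bc_domain \<Omega>1 \<Omega>2 \<inter> split_complex)"
proof -
  have "{(u, v). u + v \<in> of_real -` \<Omega>1 \<and> u - v \<in> of_real -` \<Omega>2} =
    (\<lambda>p. of_real (fst p + snd p)) -` \<Omega>1 \<inter> (\<lambda>p. of_real (fst p - snd p)) -` \<Omega>2" 
    by auto
  moreover have "open \<dots>"
    using assms by (intro open_Int open_vimage continuous_intros)
  ultimately show ?thesis
    by (simp add: split_open_def split_coords_bc_domain)
qed

text \<open>The velocity of the curve that \<open>X\<close> traces over the real axis.\<close>

definition real_form :: "(complex \<Rightarrow> complex) \<Rightarrow> (complex \<Rightarrow> complex) \<Rightarrow> real \<Rightarrow> real^3"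
  where "real_form g f t = (\<chi> i. Re (weierstrass_form g f i (of_real t)))"

definition real_form_deriv :: "(complex \<Rightarrow> complex) \<Rightarrow> (complex \<Rightarrow> complex) \<Rightarrow> real \<Rightarrow> real^3"
  where "real_form_deriv g f t = (\<chi> i. Re (deriv (weierstrass_form g f i) (of_real t)))"

context
  fixes \<Omega> X g f
  assumes surf: "maximal_surface_data \<Omega> X g f"
begin

lemma maximal_surface_has_vector_derivative:
  assumes "of_real t \<in> \<Omega>"
  shows "((\<lambda>t. X (of_real t)) has_vector_derivative real_form g f t) (at t)"
  by (rule has_vector_derivative_vecI)
    (use maximal_surface_has_real_derivative[OF surf assms] in \<open>simp add: real_form_def\<close>)

lemma real_form_has_vector_derivative:
  assumes "of_real t \<in> \<Omega>"
  shows "(real_form g f has_vector_derivative real_form_deriv g f t) (at t)"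
proof (rule has_vector_derivative_vecI)
  fix i
  have "(weierstrass_form g f i has_field_derivative deriv (weierstrass_form g f i) (of_real t)) (at (of_real t))"
    using weierstrass_form_holomorphic[OF surf] maximal_surface_open[OF surf] assms
    by (auto intro: holomorphic_derivI)
  from bounded_linear.has_vector_derivative[OF bounded_linear_Re has_vector_derivative_real_field[OF this]]
  show "((\<lambda>t. real_form g f t $ i) has_real_derivative real_form_deriv g f t $ i) (at t)"
    by (simp add: real_form_def real_form_deriv_def has_real_derivative_iff_has_vector_derivative)
qed

lemma continuous_on_real_form:
  "continuous_on (of_real -` \<Omega>) (real_form g f)" "continuous_on (of_real -` \<Omega>) (real_form_deriv g f)"
proof -
  have c: "continuous_on \<Omega> (weierstrass_form g f i)" "continuous_on \<Omega> (deriv (weierstrass_form g f i))" for i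
    using weierstrass_form_holomorphic[OF surf] maximal_surface_open[OF surf]
    by (auto intro!: holomorphic_on_imp_continuous_on holomorphic_deriv)
  show "continuous_on (of_real -` \<Omega>) (real_form g f)"
    unfolding real_form_def
    by (intro continuous_on_vec_lambda continuous_on_Re continuous_on_compose2[OF c(1)]
        continuous_on_of_real continuous_on_id) auto
  show "continuous_on (of_real -` \<Omega>) (real_form_deriv g f)"
    unfolding real_form_deriv_def
    by (intro continuous_on_vec_lambda continuous_on_Re continuous_on_compose2[OF c(2)]
        continuous_on_of_real continuous_on_id) auto
qed

text \<open>The complex null relation passes to real parts because the form equals its real part at
  real points.\<close>

lemma real_form_null:
  assumes "\<And>z. z \<in> \<Omega> \<inter> \<real> \<Longrightarrow> g z \<in> \<real>" "\<And>z. z \<in> \<Omega> \<inter> \<real> \<Longrightarrow> f z \<in> \<real>" "of_real t \<in> \<Omega>"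
  shows "lorentz (real_form g f t) (real_form g f t) = 0"
proof -
  have "weierstrass_form g f i (of_real t) = of_real (real_form g f t $ i)" for i
    using weierstrass_form_real[OF surf assms(1,2), of "of_real t" i] assms(3)
    by (simp add: real_form_def of_real_Re)
  then have "of_real (lorentz (real_form g f t) (real_form g f t)) = (0 :: complex)"
    using weierstrass_form_null[OF surf assms(3)] by (simp add: lorentz_def power2_eq_square)
  then show ?thesis by (simp only: of_real_eq_0_iff)
qed

end

lemma lorentz_arith:
  "lorentz (x + y) z = lorentz x z + lorentz y z" "lorentz x (y + z) = lorentz x y + lorentz x z"
  "lorentz (- x) z = - lorentz x z" "lorentz x (- z) = - lorentz x z"
  "lorentz (c *\<^sub>R x) z = c * lorentz x z" "lorentz x (c *\<^sub>R z) = c * lorentz x z"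
  by (simp_all add: lorentz_def algebra_simps)

lemma lorentz_commute: "lorentz x y = lorentz y x"
  by (simp add: lorentz_def)

lemma bc_fun_weierstrass_vec:
  "weierstrass_vec (bc_fun g1 g2 q) (bc_fun f1 f2 q) $ i =
    bc_fun (\<lambda>z. weierstrass_vec (g1 z) (f1 z) $ i) (\<lambda>z. weierstrass_vec (g2 z) (f2 z) $ i) q"
  using exhaust_3[of i] by (auto simp: weierstrass_vec_def bc_fun_def intro!: idem_eqI)

section \<open>Gauss maps near real points\<close>

lemma eventually_at_conv_of_real:
  assumes "eventually P (at (of_real a :: complex))"
  shows "eventually (\<lambda>t. P (of_real t)) (at a)"
proof -
  have "filterlim (of_real :: real \<Rightarrow> complex) (at (of_real a)) (at a)"
    unfolding filterlim_at by (auto intro!: tendsto_eq_intros simp: eventually_at_filter)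
  then show ?thesis
    using assms by (rule eventually_compose_filterlim[rotated])
qed

text \<open>A constant value on a real interval would be taken on the whole component, and being real
  it would contradict the assumption on the imaginary part of the Gauss map.\<close>

lemma maximal_surface_frequently_neq:
  assumes surf: "maximal_surface_data \<Omega> X g f" and a: "of_real a \<in> \<Omega>" and c: "c \<in> \<real>"
  shows "frequently (\<lambda>t. g (of_real t) \<noteq> c) (at a)"
proof (rule ccontr)
  assume "\<not> ?thesis"
  then have ev: "eventually (\<lambda>t. g (of_real t) = c) (at a)"
    by (simp add: frequently_def)
  define C where "C = connected_component_set \<Omega> (of_real a)"
  have C: "C \<in> components \<Omega>" "of_real a \<in> C"
    using a by (auto simp: C_def componentsI)
  have "frequently (\<lambda>z. g z = c) (at (of_real a))"
  proof (rule ccontr)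
    assume "\<not> ?thesis"
    then have "eventually (\<lambda>z. g z \<noteq> c) (at (of_real a))"
      by (simp add: frequently_def)
    from eventually_conj[OF eventually_at_conv_of_real[OF this] ev]
    have "eventually (\<lambda>t. False) (at a)" by eventually_elim auto
    then show False by simp
  qed
  moreover have "open C" "connected C" "C \<subseteq> \<Omega>"
    using C surf by (auto simp: maximal_surface_data_def open_components in_components_connected
        in_components_subset)
  moreover have "g nicely_meromorphic_on C"
    using surf \<open>C \<subseteq> \<Omega>\<close> by (auto simp: maximal_surface_data_def intro: nicely_meromorphic_on_subset)
  \<comment> \<open>Identity theorem on the connected open set \<open>C\<close>; for a nicely
    meromorphic function the equality holds at every point.\<close>
  ultimately have "g z = c" if "z \<in> C" for z
    using frequently_eq_meromorphic_imp_constant C(2) that by blast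
  moreover obtain z where "z \<in> C" "Im (g z) \<noteq> 0"
    using surf C(1) unfolding maximal_surface_data_def by blast
  ultimately show False using c by (auto simp: complex_is_Real_iff)
qed

lemma eventually_analytic_at_nicely_meromorphic:
  assumes "g nicely_meromorphic_on \<Omega>" "open \<Omega>" "z \<in> \<Omega>"
  shows "eventually (\<lambda>w. g analytic_on {w}) (at z)"
proof -
  have "isolated_singularity_at g z"
    using assms by (auto simp: nicely_meromorphic_on_def meromorphic_on_altdef)
  then obtain r where "r > 0" "g analytic_on ball z r - {z}"
    by (auto simp: isolated_singularity_at_def)
  then show ?thesis
    unfolding eventually_at
    by (intro exI[of _ r]) (auto simp: dist_commute intro: analytic_on_subset)
qed

section \<open>The half sum as a surface with Weierstrass data\<close>

context
  fixes \<Omega>1 \<Omega>2 X1 X2 g1 f1 g2 f2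
  assumes surf: "maximal_surface_data \<Omega>1 X1 g1 f1" "maximal_surface_data \<Omega>2 X2 g2 f2"
    and sym: "bc_symmetric_on (bc_fun g1 g2) (bc_domain \<Omega>1 \<Omega>2)"
      "bc_symmetric_on (bc_fun f1 f2) (bc_domain \<Omega>1 \<Omega>2)"
begin

lemma timelike_minimal_surface_half_sum:
  "timelike_minimal_surface (bc_domain \<Omega>1 \<Omega>2 \<inter> split_complex) (half_sum X1 X2)"
proof -
  let ?S = "bc_domain \<Omega>1 \<Omega>2 \<inter> split_complex"
  let ?A = "of_real -` \<Omega>1 :: real set" and ?B = "of_real -` \<Omega>2 :: real set"
  define U where "U = split_coords ?S"
  define Y where "Y = (\<lambda>(u, v). half_sum X1 X2 (split_of u v))"
  let ?h = "\<lambda>F t. (1/2) *\<^sub>R F t :: real^3"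
  let ?a = "?h (real_form g1 f1)" and ?b = "?h (real_form g2 f2)"
  let ?a' = "?h (real_form_deriv g1 f1)" and ?b' = "?h (real_form_deriv g2 f2)"
  note opn = surf[THEN maximal_surface_open]
  have op: "open ?A" "open ?B"
    using opn by (auto intro!: open_vimage continuous_intros)
  have U: "U = {(u, v). u + v \<in> ?A \<and> u - v \<in> ?B}"
    unfolding U_def by (rule split_coords_bc_domain)
  have Y: "Y (u, v) = ?h (\<lambda>t. X1 (of_real t)) (u + v) + ?h (\<lambda>t. X2 (of_real t)) (u - v)" for u v
    by (simp add: Y_def half_sum_def idem_split_of scaleR_add_right)
  have d: "t \<in> ?A \<Longrightarrow> (?h (\<lambda>t. X1 (of_real t)) has_vector_derivative ?a t) (at t)"
      "t \<in> ?B \<Longrightarrow> (?h (\<lambda>t. X2 (of_real t)) has_vector_derivative ?b t) (at t)"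
      "t \<in> ?A \<Longrightarrow> (?a has_vector_derivative ?a' t) (at t)"
      "t \<in> ?B \<Longrightarrow> (?b has_vector_derivative ?b' t) (at t)"
      "t \<in> ?B \<Longrightarrow> ((\<lambda>t. - ?b t) has_vector_derivative - ?b' t) (at t)" for t
    using surf[THEN maximal_surface_has_vector_derivative, of t]
      surf[THEN real_form_has_vector_derivative, of t]
    by (auto intro!: has_vector_derivative_minus bounded_linear.has_vector_derivative[OF bounded_linear_scaleR_right])
  have c: "continuous_on ?A ?a" "continuous_on ?B ?b" "continuous_on ?A ?a'" "continuous_on ?B ?b'"
      "continuous_on ?B (\<lambda>t. - ?b' t)"
    using surf[THEN continuous_on_real_form(1)] surf[THEN continuous_on_real_form(2)]
    by (auto intro!: continuous_intros)
  have Y1: "C1_on U Y" "\<And>u v. (u, v) \<in> U \<Longrightarrow> partial_u Y (u, v) = ?a (u + v) + ?b (u - v)"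
    "\<And>u v. (u, v) \<in> U \<Longrightarrow> partial_v Y (u, v) = ?a (u + v) + - ?b (u - v)"
    by (rule d_Alembert[OF op d(1,2) c(1,2) U Y]; assumption)+
  have Yu: "C1_on U (partial_u Y)" "\<And>u v. (u, v) \<in> U \<Longrightarrow> partial_u (partial_u Y) (u, v) = ?a' (u + v) + ?b' (u - v)"
    "\<And>u v. (u, v) \<in> U \<Longrightarrow> partial_v (partial_u Y) (u, v) = ?a' (u + v) + - ?b' (u - v)"
    by (rule d_Alembert[OF op d(3,4) c(3,4) U Y1(2)]; assumption)+
  \<comment> \<open>The second generator of \<open>partial_v Y\<close> is the negative of
    \<open>?b\<close>, so a further derivative in \<open>v\<close> restores the sign and equals the
    second derivative in \<open>u\<close>.\<close>
  have Yv: "C1_on U (partial_v Y)" "\<And>u v. (u, v) \<in> U \<Longrightarrow> partial_u (partial_v Y) (u, v) = ?a' (u + v) + (\<lambda>t. - ?b' t) (u - v)"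
    "\<And>u v. (u, v) \<in> U \<Longrightarrow> partial_v (partial_v Y) (u, v) = ?a' (u + v) + - (\<lambda>t. - ?b' t) (u - v)"
    by (rule d_Alembert[OF op d(3,5) c(3,5) U Y1(3)]; assumption)+
  have "C2_on U Y"
    unfolding C2_on_def using Y1(1) Yu(1) Yv(1) by blast
  moreover have "lorentz (partial_u Y (u, v)) (partial_u Y (u, v)) = - lorentz (partial_v Y (u, v)) (partial_v Y (u, v)) \<and>
         lorentz (partial_u Y (u, v)) (partial_v Y (u, v)) = 0 \<and>
         partial_u (partial_u Y) (u, v) - partial_v (partial_v Y) (u, v) = 0" if uv: "(u, v) \<in> U" for u v
  proof -
    have mem: "of_real (u + v) \<in> \<Omega>1 \<inter> \<real>" "of_real (u - v) \<in> \<Omega>2 \<inter> \<real>"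
      using uv by (simp_all add: U)
    have n: "lorentz (real_form g1 f1 (u + v)) (real_form g1 f1 (u + v)) = 0"
      "lorentz (real_form g2 f2 (u - v)) (real_form g2 f2 (u - v)) = 0"
      using real_form_null[OF surf(1), of "u + v"] real_form_null[OF surf(2), of "u - v"] mem
        bc_symmetric_on_bc_fun_real[OF sym(1)] bc_symmetric_on_bc_fun_real[OF sym(2)] by blast+
    \<comment> \<open>For null \<open>a\<close> and \<open>b\<close>, \<open>a + b\<close> and
      \<open>a - b\<close> have squares \<open>2 <a,b>\<close> and \<open>-2 <a,b>\<close>, and
      their product \<open><a,a> - <b,b>\<close> vanishes.\<close>
    show ?thesis
      unfolding Y1(2,3)[OF uv] Yu(2)[OF uv] Yv(3)[OF uv] lorentz_arith n
        lorentz_commute[of "real_form g2 f2 (u - v)" "real_form g1 f1 (u + v)"]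
      by simp
  qed
  ultimately show ?thesis
    using split_open_bc_domain[OF opn]
    by (auto simp: timelike_minimal_surface_def Let_def U_def Y_def)
qed

text \<open>At real coordinates \<open>s\<close>, \<open>t\<close> the split-imaginary part is half
  of \<open>g1 s - g2 t\<close>. Choosing \<open>t\<close> first makes \<open>g2 t\<close> a real
  constant, a value that \<open>g1\<close> cannot keep on a real interval.\<close>

lemma split_components_Im_nonzero:
  assumes C: "C \<in> components (bc_domain \<Omega>1 \<Omega>2 \<inter> split_complex)"
  shows "\<exists>q\<in>C. split_analytic_at (bc_fun g1 g2) q \<and> split_Im (bc_fun g1 g2 q) \<noteq> 0"
proof -
  let ?S = "bc_domain \<Omega>1 \<Omega>2 \<inter> split_complex"
  note opn = surf[THEN maximal_surface_open]
  have mero: "g1 nicely_meromorphic_on \<Omega>1" "g2 nicely_meromorphic_on \<Omega>2"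
    using surf by (auto simp: maximal_surface_data_def)
  obtain q0 where q0: "q0 \<in> C" using in_components_nonempty[OF C] by blast
  have "C \<subseteq> ?S" using C by (rule in_components_subset)
  then have "q0 \<in> ?S" using q0 by blast
  then obtain a b where ab: "idem1 q0 = of_real a" "idem2 q0 = of_real b"
      "of_real a \<in> \<Omega>1" "of_real b \<in> \<Omega>2"
    by (auto simp: mem_bc_domain_iff mem_split_complex_iff elim!: Reals_cases)
  obtain r1 r2 where r: "r1 > 0" "ball (of_real a) r1 \<subseteq> \<Omega>1" "r2 > 0" "ball (of_real b) r2 \<subseteq> \<Omega>2"
    using opn ab by (meson open_contains_ball)
  \<comment> \<open>\<open>C\<close> contains a full box around \<open>q0\<close> in null
    coordinates, so \<open>s\<close> and \<open>t\<close> can be varied independently.\<close>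
  have in_C: "bc_idem (of_real s) (of_real t) \<in> C" if st: "dist s a < r1" "dist t b < r2" for s t
  proof -
    let ?seg = "closed_segment q0 (bc_idem (of_real s) (of_real t))"
    have "?seg \<subseteq> ?S"
    proof
      fix q assume "q \<in> ?seg"
      then obtain u where u: "0 \<le> u" "u \<le> 1" "q = (1 - u) *\<^sub>R q0 + u *\<^sub>R bc_idem (of_real s) (of_real t)"
        by (auto simp: closed_segment_def)
      have i: "idem1 q = of_real ((1 - u) *\<^sub>R a + u *\<^sub>R s)" "idem2 q = of_real ((1 - u) *\<^sub>R b + u *\<^sub>R t)"
        using ab by (simp_all add: u(3) scaleR_conv_of_real)
      have "(1 - u) *\<^sub>R a + u *\<^sub>R s \<in> ball a r1" "(1 - u) *\<^sub>R b + u *\<^sub>R t \<in> ball b r2"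
        using convexD_alt[OF convex_ball, of a a r1 s u] convexD_alt[OF convex_ball, of b b r2 t u] st r u
        by (simp_all add: dist_commute)
      then have "idem1 q \<in> ball (of_real a) r1" "idem2 q \<in> ball (of_real b) r2"
        unfolding i by (simp_all only: mem_ball dist_of_real)
      then show "q \<in> ?S"
        using r i by (auto simp: mem_bc_domain_iff mem_split_complex_iff)
    qed
    then have "?seg \<subseteq> C"
      using q0 by (intro components_maximal[OF C]) auto
    then show ?thesis by auto
  qed
  have near: "eventually (\<lambda>s. dist s a < r1) (at a)" "eventually (\<lambda>t. dist t b < r2) (at b)"
    using r by (auto simp: eventually_at)
  have "eventually (\<lambda>t. g2 analytic_on {of_real t} \<and> dist t b < r2) (at b)"
    by (rule eventually_conj[OF eventually_at_conv_of_real near(2)]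
        eventually_analytic_at_nicely_meromorphic[OF mero(2) opn(2) ab(4)])+
  then obtain t where t: "g2 analytic_on {of_real t}" "dist t b < r2"
    using eventually_happens'[OF at_neq_bot] by blast
  \<comment> \<open>The point \<open>a\<close> serves as the real partner that the symmetry needs to
    make \<open>g2 t\<close> real.\<close>
  have "bc_idem (of_real a) (of_real t) \<in> ?S"
    using in_C[of a t] t r \<open>C \<subseteq> ?S\<close> by auto
  then have t_real: "g2 (of_real t) \<in> \<real>"
    using bc_symmetric_on_bc_fun_real(2)[OF sym(1), of "of_real a" "of_real t"]
    by (simp add: mem_bc_domain_iff)
  have "eventually (\<lambda>s. g1 analytic_on {of_real s} \<and> dist s a < r1) (at a)"
    by (rule eventually_conj[OF eventually_at_conv_of_real near(1)]
        eventually_analytic_at_nicely_meromorphic[OF mero(1) opn(1) ab(3)])+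
  then obtain s where s: "g1 analytic_on {of_real s}" "dist s a < r1" "g1 (of_real s) \<noteq> g2 (of_real t)"
    using frequently_eventually_frequently[OF maximal_surface_frequently_neq[OF surf(1) ab(3) t_real]]
    by (auto dest: frequently_ex)
  let ?q = "bc_idem (of_real s) (of_real t)"
  have q: "?q \<in> C" "?q \<in> ?S"
    using in_C s t \<open>C \<subseteq> ?S\<close> by auto
  obtain B1 B2 where B: "open B1" "of_real s \<in> B1" "g1 holomorphic_on B1"
      "open B2" "of_real t \<in> B2" "g2 holomorphic_on B2"
    using s(1) t(1) by (auto simp: analytic_at)
  \<comment> \<open>Holomorphy is available on \<open>B1\<close> and \<open>B2\<close>, reality on
    the original domains, hence the intersections.\<close>
  have "split_analytic_at (bc_fun g1 g2) ?q"
    by (rule split_analytic_at_bc_fun[of _ "B1 \<inter> \<Omega>1" _ "B2 \<inter> \<Omega>2"])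
      (use B opn q bc_symmetric_on_bc_fun_real(1)[OF sym(1), of _ "of_real b"]
         bc_symmetric_on_bc_fun_real(2)[OF sym(1), of "of_real a"] ab(3,4) in
       \<open>auto simp: mem_bc_domain_iff intro: holomorphic_on_subset\<close>)
  moreover have "Re (g1 (of_real s)) \<noteq> Re (g2 (of_real t))"
    using s(3) t_real bc_symmetric_on_bc_fun_real(1)[OF sym(1), of "of_real s" "of_real t"] q(2)
    by (auto simp: mem_bc_domain_iff complex_is_Real_iff complex_eq_iff)
  then have "split_Im (bc_fun g1 g2 ?q) \<noteq> 0"
    by (simp add: split_Im_idem bc_fun_def)
  ultimately show ?thesis using q(1) by blast
qed

text \<open>\<open>split_Re\<close> is half the sum of the real parts of the two coordinates, which
  accounts for the factor one half in \<open>half_sum\<close>.\<close>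

lemma half_sum_increment:
  assumes \<gamma>: "valid_path \<gamma>" "path_image \<gamma> \<subseteq> bc_domain \<Omega>1 \<Omega>2"
  shows "half_sum X1 X2 (pathfinish \<gamma>) $ i - half_sum X1 X2 (pathstart \<gamma>) $ i =
    split_Re (split_contour_integral \<gamma> (bc_fun (weierstrass_form g1 f1 i) (weierstrass_form g2 f2 i)))"
proof -
  have "valid_path (idem1 \<circ> \<gamma>)" "valid_path (idem2 \<circ> \<gamma>)"
    using \<gamma>(1) linear_idem by (auto intro: linear_image_valid_path)
  moreover have "path_image (idem1 \<circ> \<gamma>) \<subseteq> \<Omega>1" "path_image (idem2 \<circ> \<gamma>) \<subseteq> \<Omega>2"
    using \<gamma>(2) by (auto simp: path_image_def mem_bc_domain_iff)
  ultimately have "X1 (idem1 (pathfinish \<gamma>)) $ i - X1 (idem1 (pathstart \<gamma>)) $ i =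
      Re (contour_integral (idem1 \<circ> \<gamma>) (weierstrass_form g1 f1 i))"
    "X2 (idem2 (pathfinish \<gamma>)) $ i - X2 (idem2 (pathstart \<gamma>)) $ i =
      Re (contour_integral (idem2 \<circ> \<gamma>) (weierstrass_form g2 f2 i))"
    using maximal_surface_increment[OF surf(1), of "idem1 \<circ> \<gamma>"]
      maximal_surface_increment[OF surf(2), of "idem2 \<circ> \<gamma>"]
    by (simp_all add: pathstart_compose pathfinish_compose)
  then show ?thesis
    using split_contour_integral_bc_fun[OF surf[THEN weierstrass_form_holomorphic]
        surf[THEN maximal_surface_open] \<gamma>]
    by (simp add: half_sum_def split_Re_idem field_simps)
qed

text \<open>If the real domain is empty, there is no pair of real points from which to infer
  reality, but all conditions are then vacuous. Otherwise one fixed pair \<open>a\<close>,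
  \<open>b\<close> supplies partners for all real points.\<close>

lemma split_weierstrass_data_half_sum:
  "split_weierstrass_data (bc_domain \<Omega>1 \<Omega>2 \<inter> split_complex) (half_sum X1 X2) (bc_fun g1 g2) (bc_fun f1 f2)"
proof (cases "bc_domain \<Omega>1 \<Omega>2 \<inter> split_complex = {}")
  case True
  have "split_meromorphic_on (bc_fun g1 g2) {}"
    unfolding split_meromorphic_on_def by (auto simp: split_holomorphic_on_def)
  then show ?thesis
    unfolding True split_weierstrass_data_def
    by (auto simp: split_holomorphic_on_def split_extends_def)
next
  case False
  let ?S = "bc_domain \<Omega>1 \<Omega>2 \<inter> split_complex"
  note opn = surf[THEN maximal_surface_open]
  obtain a b where ab: "a \<in> \<Omega>1 \<inter> \<real>" "b \<in> \<Omega>2 \<inter> \<real>"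
    using False by (meson IntE IntI ex_in_conv mem_bc_domain_iff mem_split_complex_iff)
  have re: "g1 z \<in> \<real>" "f1 z \<in> \<real>" if "z \<in> \<Omega>1 \<inter> \<real>" for z
    using bc_symmetric_on_bc_fun_real(1)[OF sym(1) that ab(2)]
      bc_symmetric_on_bc_fun_real(1)[OF sym(2) that ab(2)] by auto
  have re': "g2 z \<in> \<real>" "f2 z \<in> \<real>" if "z \<in> \<Omega>2 \<inter> \<real>" for z
    using bc_symmetric_on_bc_fun_real(2)[OF sym(1) ab(1) that]
      bc_symmetric_on_bc_fun_real(2)[OF sym(2) ab(1) that] by auto
  define \<Phi> where "\<Phi> i = bc_fun (weierstrass_form g1 f1 i) (weierstrass_form g2 f2 i)" for i
  have hol: "f1 holomorphic_on \<Omega>1" "f2 holomorphic_on \<Omega>2"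
    using surf by (auto simp: maximal_surface_data_def)
  have f: "split_holomorphic_on (bc_fun f1 f2) ?S"
    unfolding split_holomorphic_on_def
    using split_analytic_at_bc_fun[OF hol opn re(2) re'(2)] by blast
  have g: "split_meromorphic_on (bc_fun g1 g2) ?S"
    unfolding split_meromorphic_on_def
  proof (intro disjI2 exI conjI)
    show "g1 nicely_meromorphic_on \<Omega>1" "g2 nicely_meromorphic_on \<Omega>2"
      using surf by (simp_all add: maximal_surface_data_def)
  qed (use opn sym(1) in auto)
  have \<Phi>: "split_extends (\<Phi> i) (\<lambda>q. weierstrass_vec (bc_fun g1 g2 q) (bc_fun f1 f2 q) $ i) ?S" for i
    unfolding \<Phi>_def bc_fun_weierstrass_vec
    by (rule split_extends_bc_fun[OF surf[THEN weierstrass_form_holomorphic] opn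
        weierstrass_form_real[OF surf(1) re] weierstrass_form_real[OF surf(2) re']
        surf[THEN eventually_weierstrass_form_eq]])
  \<comment> \<open>\<open>f g\<^sup>2\<close> is half the difference of the third and the first Weierstrass component.\<close>
  define h where "h g f z = (weierstrass_form g f 3 z - weierstrass_form g f 1 z) / 2" for g f z
  have h_ev: "eventually (\<lambda>w. f w * (g w)\<^sup>2 = h g f w) (at z)"
    if "maximal_surface_data \<Omega> X g f" "z \<in> \<Omega>" for \<Omega> X g f z
    using eventually_weierstrass_form_eq[OF that, of 1] eventually_weierstrass_form_eq[OF that, of 3]
  proof eventually_elim
    case (elim w)
    show ?case
      unfolding h_def elim[symmetric] by (simp add: weierstrass_vec_def algebra_simps)
  qed
  have "split_extends (bc_fun (h g1 f1) (h g2 f2))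
      (bc_fun (\<lambda>z. f1 z * (g1 z)\<^sup>2) (\<lambda>z. f2 z * (g2 z)\<^sup>2)) ?S"
  proof (rule split_extends_bc_fun[OF _ _ opn _ _ surf[THEN h_ev]])
    show "h g1 f1 holomorphic_on \<Omega>1" "h g2 f2 holomorphic_on \<Omega>2"
      unfolding h_def using surf[THEN weierstrass_form_holomorphic] by (auto intro!: holomorphic_intros)
    show "h g1 f1 z \<in> \<real>" if "z \<in> \<Omega>1 \<inter> \<real>" for z
      unfolding h_def using weierstrass_form_real[OF surf(1) re that]
      by (auto intro!: Reals_divide Reals_diff)
    show "h g2 f2 z \<in> \<real>" if "z \<in> \<Omega>2 \<inter> \<real>" for z
      unfolding h_def using weierstrass_form_real[OF surf(2) re' that]
      by (auto intro!: Reals_divide Reals_diff)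
  qed
  also have "bc_fun (\<lambda>z. f1 z * (g1 z)\<^sup>2) (\<lambda>z. f2 z * (g2 z)\<^sup>2) =
      (\<lambda>q. bc_fun f1 f2 q * (bc_fun g1 g2 q)\<^sup>2)"
    by (auto simp: bc_fun_def intro!: ext idem_eqI)
  finally have fg: "\<exists>H. split_extends H (\<lambda>q. bc_fun f1 f2 q * (bc_fun g1 g2 q)\<^sup>2) ?S" by blast
  have incr: "half_sum X1 X2 (pathfinish \<gamma>) $ i - half_sum X1 X2 (pathstart \<gamma>) $ i =
      split_Re (split_contour_integral \<gamma> (\<Phi> i))" if "valid_path \<gamma>" "path_image \<gamma> \<subseteq> ?S" for \<gamma> i
    unfolding \<Phi>_def using half_sum_increment that by blast
  have per: "split_Re (split_contour_integral \<gamma> (\<Phi> i)) = 0"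
    if "valid_path \<gamma>" "path_image \<gamma> \<subseteq> ?S" "pathfinish \<gamma> = pathstart \<gamma>" for \<gamma> i
    using incr[OF that(1,2), of i] that(3) by simp
  have prim: "\<exists>q0\<in>C. \<exists>c::real^3. \<forall>q\<in>C. \<forall>\<gamma>. valid_path \<gamma> \<and> path_image \<gamma> \<subseteq> ?S \<and>
      pathstart \<gamma> = q0 \<and> pathfinish \<gamma> = q \<longrightarrow>
      (\<forall>i. half_sum X1 X2 q $ i = c $ i + split_Re (split_contour_integral \<gamma> (\<Phi> i)))"
    if C: "C \<in> components ?S" for C
  proof -
    \<comment> \<open>Any point of \<open>C\<close> can be the base point, with its own value as
      additive constant, since \<open>incr\<close> holds between arbitrary endpoints.\<close>
    obtain q0 where "q0 \<in> C" using in_components_nonempty[OF C] by blast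
    then show ?thesis
      by (intro bexI[of _ q0] exI[of _ "half_sum X1 X2 q0"]) (auto simp flip: incr)
  qed
  show ?thesis
    unfolding split_weierstrass_data_def
    using f g fg split_components_Im_nonzero \<Phi> per prim by (intro conjI exI[of _ \<Phi>]) blast+
qed

end

theorem proposition3p1:
  fixes \<Omega>1 \<Omega>2 :: "complex set"
    and X1 X2 :: "complex \<Rightarrow> real^3"
    and g1 f1 g2 f2 :: "complex \<Rightarrow> complex"
  assumes "maximal_surface_data \<Omega>1 X1 g1 f1"
    and "maximal_surface_data \<Omega>2 X2 g2 f2"
    and "bc_symmetric_on (bc_fun g1 g2) (bc_domain \<Omega>1 \<Omega>2)"
    and "bc_symmetric_on (bc_fun f1 f2) (bc_domain \<Omega>1 \<Omega>2)"
  shows "timelike_minimal_surface (bc_domain \<Omega>1 \<Omega>2 \<inter> split_complex) (half_sum X1 X2) \<and>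
         split_weierstrass_data (bc_domain \<Omega>1 \<Omega>2 \<inter> split_complex) (half_sum X1 X2)
           (bc_fun g1 g2) (bc_fun f1 f2)"
  using timelike_minimal_surface_half_sum[OF assms] split_weierstrass_data_half_sum[OF assms] by blast

end
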